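(* Let $p=p(k)$ satisfy $k^{-3/2}\ll p\le 10\frac{\ln k}{k}$ as $k\to\infty$. Let $\mu$ and $\sigma^2$ be the mean and variance of the (unconditioned) random variable $M$. Then for every fixed real $u$, $$\Pr[M^*\le \mu+u\sigma]\to \int_{-\infty}^{u}\frac{1}{\sqrt{2\pi}}e^{-t^2/2}\,dt\quad (k\to\infty).$$
   Context: Tilted balls-into-bins model with tilt $p$ (integer $k\ge2$): $k-1$ balls $j=1,\dots,k-1$ are placed independently, ball $j$ into bin $T_j\in\{1,\dots,k\}$ with $\Pr[T_j=i]=\frac{p(1-p)^{i-1}}{1-(1-p)^k}$. Let $Z_i$ be the number of balls in bin $i$, $Y_0=1$, $Y_i=Y_{i-1}+Z_i-1$; $\mathrm{TREE}$ is the event $Y_t>0$ for $1\le t\le k-1$. $M=\binom{k}{2}-\sum_{j=1}^{k-1}T_j$, and $M^*$ is $M$ in the probability space conditioned on $\mathrm{TREE}$. *)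

theory Defs
  imports "HOL-Probability.Probability"
begin

text \<open>
  The function passed to \<^const>\<open>embed_pmf\<close> is a probability mass function whenever
  \<open>0 < p < 1\<close> and \<open>k \<ge> 1\<close> (see \<open>pmf_bin_pmf\<close> below); for other parameters
  \<open>bin_pmf\<close> is unspecified.
\<close>

definition bin_pmf :: "nat \<Rightarrow> real \<Rightarrow> nat pmf" where
  "bin_pmf k p =
     embed_pmf (\<lambda>i. if i \<in> {1..k} then p * (1 - p) ^ (i - 1) / (1 - (1 - p) ^ k) else 0)"

definition balls_pmf :: "nat \<Rightarrow> real \<Rightarrow> (nat \<Rightarrow> nat) pmf" where
  "balls_pmf k p = Pi_pmf {1..k - 1} 0 (\<lambda>_. bin_pmf k p)"

definition Z :: "nat \<Rightarrow> (nat \<Rightarrow> nat) \<Rightarrow> nat \<Rightarrow> nat" where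
  "Z k T i = card {j \<in> {1..k - 1}. T j = i}"

primrec Y :: "nat \<Rightarrow> (nat \<Rightarrow> nat) \<Rightarrow> nat \<Rightarrow> int" where
  "Y k T 0 = 1"
| "Y k T (Suc i) = Y k T i + int (Z k T (Suc i)) - 1"

definition TREE :: "nat \<Rightarrow> (nat \<Rightarrow> nat) set" where
  "TREE k = {T. \<forall>t\<in>{1..k - 1}. Y k T t > 0}"

definition M :: "nat \<Rightarrow> (nat \<Rightarrow> nat) \<Rightarrow> real" where
  "M k T = real (k choose 2) - (\<Sum>j = 1..k - 1. real (T j))"

definition mean_M :: "nat \<Rightarrow> real \<Rightarrow> real" where
  "mean_M k p = measure_pmf.expectation (balls_pmf k p) (M k)"

definition var_M :: "nat \<Rightarrow> real \<Rightarrow> real" where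
  "var_M k p = measure_pmf.variance (balls_pmf k p) (M k)"

definition M_star_pmf :: "nat \<Rightarrow> real \<Rightarrow> real pmf" where
  "M_star_pmf k p = map_pmf (M k) (cond_pmf (balls_pmf k p) (TREE k))"

lemma
  assumes p: "0 < p" "p < 1" and k: "1 \<le> k"
  shows pmf_bin_pmf: "pmf (bin_pmf k p) i =
      (if i \<in> {1..k} then p * (1 - p) ^ (i - 1) / (1 - (1 - p) ^ k) else 0)" (is ?A)
    and set_bin_pmf: "set_pmf (bin_pmf k p) = {1..k}" (is ?B)
proof -
  let ?f = "\<lambda>i. if i \<in> {1..k} then p * (1 - p) ^ (i - 1) / (1 - (1 - p) ^ k) else 0"
  have lt: "(1 - p) ^ k < 1"
    using p k by (simp add: power_less_one_iff)
  have nonneg: "0 \<le> ?f i" for i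
    using p lt by auto
  have "(\<Sum>i\<in>{1..k}. p * (1 - p) ^ (i - 1)) = (\<Sum>i<k. p * (1 - p) ^ i)"
    by (rule sum.reindex_bij_witness[of _ Suc "\<lambda>i. i - 1"]) auto
  also have "\<dots> = 1 - (1 - p) ^ k"
    using one_diff_power_eq[of "1 - p" k] by (simp add: sum_distrib_left)
  finally have "(\<Sum>i\<in>{1..k}. ?f i) = 1"
    using lt by (simp flip: sum_divide_distrib)
  moreover have "(\<integral>\<^sup>+i. ennreal (?f i) \<partial>count_space UNIV) = (\<Sum>i\<in>{1..k}. ennreal (?f i))"
    by (rule nn_integral_count_space'[of "{1..k}"]) auto
  ultimately have total: "(\<integral>\<^sup>+i. ennreal (?f i) \<partial>count_space UNIV) = 1"
    using sum_ennreal[of "{1..k}" ?f, OF nonneg] by simp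
  show ?A
    unfolding bin_pmf_def by (rule pmf_embed_pmf[OF nonneg total])
  show ?B
    unfolding bin_pmf_def using set_embed_pmf[OF nonneg total] p lt by auto
qed

text \<open>The conditioning in \<open>M_star_pmf\<close> is on an event of positive probability.\<close>

lemma balls_pmf_TREE_nonempty:
  assumes p: "0 < p" "p < 1" and k: "1 \<le> k"
  shows "set_pmf (balls_pmf k p) \<inter> TREE k \<noteq> {}"
proof -
  define T where "T = (\<lambda>j. if j \<in> {1..k - 1} then j else 0)"
  have "T \<in> set_pmf (balls_pmf k p)"
    unfolding balls_pmf_def using set_bin_pmf[OF p k]
    by (auto simp: set_Pi_pmf PiE_dflt_def T_def)
  moreover have "Z k T i = 1" if "i \<in> {1..k - 1}" for i
  proof -
    have "{j \<in> {1..k - 1}. T j = i} = {i}"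
      using that by (auto simp: T_def)
    thus ?thesis
      by (simp add: Z_def)
  qed
  hence "Y k T t = 1" if "t \<le> k - 1" for t
    using that by (induction t) auto
  hence "T \<in> TREE k"
    by (auto simp: TREE_def)
  ultimately show ?thesis
    by blast
qed

end

theory Submission
  imports Defs "HOL-Real_Asymp.Real_Asymp"
begin

text \<open>
  The proof compares \<open>M\<close> conditioned on \<open>TREE\<close> with the unconditioned \<open>M\<close> by stochastic domination.
  Let \<open>N\<^sub>t\<close> be the number of balls in the bins \<open>1..t\<close>. Then \<open>Y\<^sub>t = 1 + N\<^sub>t - t\<close>, and \<open>M\<close> is the sum of
  \<open>N\<^sub>t - t\<close> over \<open>0 < t < k\<close>. The path \<open>N\<close> has multinomial weight: a product of terms \<open>x ^ z / z!\<close> in its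
  increments, which are log-concave in \<open>z\<close>, so the law of the path is log-supermodular. The four
  functions theorem then shows two things: conditioning on the increasing event \<open>TREE\<close> raises \<open>M\<close>
  stochastically, and the path conditioned on \<open>Y > 0\<close> lies below the path lifted by \<open>L\<close> and conditioned
  on \<open>Y > -L\<close>. The second raises \<open>M\<close> by only \<open>L (k - 1)\<close>.

  Write \<open>c = p k\<close>. The drift of \<open>Y\<close> away from both end points is of order \<open>c / (1 + c)\<close>, and a likelihood
  ratio martingale bounds the probability that \<open>Y\<close> ever reaches \<open>-L\<close> by a multiple of \<open>(1 + c) / (c L)\<close>.
  The mass function of a ball is at most \<open>(1 + c) / k\<close>, which forces \<open>\<sigma> \<ge> \<surd>(k - 1) k / (8 (1 + c))\<close>.
  Taking \<open>L\<close> near \<open>\<surd>(\<surd>k / c)\<close>, the hitting probability and the relative shift \<open>L k / \<sigma>\<close> are both of order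
  \<open>(1 + c) / \<surd>(c \<surd>k)\<close>, up to an additive \<open>(1 + c) / \<surd>k\<close>, and these tend to 0 exactly because
  \<open>c \<surd>k = p k\<^bsup>3/2\<^esup>\<close> tends to infinity while \<open>c = O(ln k)\<close>. The central limit theorem for \<open>M\<close> concludes.
\<close>

section \<open>The four functions theorem\<close>

text \<open>From \<open>0 \<le> (C - A) * (C - B)\<close> follows
  \<open>C * (A + B) \<le> C * C + A * B\<close>, and the last hypothesis bounds this by
  \<open>C * (C + D)\<close>. This is the two-point core of the four functions theorem.\<close>

lemma add_le_of_le_of_prod_le:
  fixes A B C D :: real
  assumes "0 \<le> A" "0 \<le> B" "0 \<le> D" "A \<le> C" "B \<le> C" "A * B \<le> C * D"
  shows "A + B \<le> C + D"
proof (cases "C = 0")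
  case False
  hence "0 < C" using assms by linarith
  have "0 \<le> (C - A) * (C - B)" using assms by simp
  hence "C * (A + B) \<le> C * (C + D)" using assms(6) by (simp add: algebra_simps)
  thus ?thesis using \<open>0 < C\<close> by simp
qed (use assms in auto)

text \<open>Twice a product of sums is a double sum symmetrised in \<open>x\<close> and
  \<open>y\<close>, so it suffices to compare the summands. For \<open>x \<le> y\<close> both terms
  on the left are at most \<open>\<gamma> x * \<delta> y\<close>, and the inequalities at
  \<open>(x, x)\<close> and \<open>(y, y)\<close> multiply to the product condition of
  \<open>add_le_of_le_of_prod_le\<close>.\<close>

lemma four_functions_chain:
  fixes \<alpha> \<beta> \<gamma> \<delta> :: "'a::linorder \<Rightarrow> real"
  assumes nonneg: "\<And>x. 0 \<le> \<alpha> x" "\<And>x. 0 \<le> \<beta> x" "\<And>x. 0 \<le> \<gamma> x" "\<And>x. 0 \<le> \<delta> x"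
    and le: "\<And>x y. x \<in> K \<Longrightarrow> y \<in> K \<Longrightarrow> \<alpha> x * \<beta> y \<le> \<gamma> (min x y) * \<delta> (max x y)"
  shows "sum \<alpha> K * sum \<beta> K \<le> sum \<gamma> K * sum \<delta> K"
proof -
  have sym: "(\<Sum>x\<in>K. \<Sum>y\<in>K. f x * g y + f y * g x) = 2 * (sum f K * sum g K)"
    for f g :: "'a \<Rightarrow> real"
  proof -
    have "(\<Sum>x\<in>K. \<Sum>y\<in>K. f y * g x) = (\<Sum>x\<in>K. \<Sum>y\<in>K. f x * g y)"
      by (rule sum.swap)
    thus ?thesis by (simp add: sum.distrib sum_product)
  qed
  have "(\<Sum>x\<in>K. \<Sum>y\<in>K. \<alpha> x * \<beta> y + \<alpha> y * \<beta> x) \<le> (\<Sum>x\<in>K. \<Sum>y\<in>K. \<gamma> x * \<delta> y + \<gamma> y * \<delta> x)"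
  proof (intro sum_mono)
    fix x y assume xy: "x \<in> K" "y \<in> K"
    have *: "\<alpha> x * \<beta> y + \<alpha> y * \<beta> x \<le> \<gamma> x * \<delta> y + \<gamma> y * \<delta> x" if "x \<in> K" "y \<in> K" "x \<le> y" for x y
    proof (rule add_le_of_le_of_prod_le)
      have "(\<alpha> x * \<beta> x) * (\<alpha> y * \<beta> y) \<le> (\<gamma> x * \<delta> x) * (\<gamma> y * \<delta> y)"
        using le[of x x] le[of y y] that nonneg
        by (intro mult_mono[of "\<alpha> x * \<beta> x" "\<gamma> x * \<delta> x" "\<alpha> y * \<beta> y" "\<gamma> y * \<delta> y"]) auto
      thus "\<alpha> x * \<beta> y * (\<alpha> y * \<beta> x) \<le> \<gamma> x * \<delta> y * (\<gamma> y * \<delta> x)"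
        by (simp add: mult_ac)
    qed (use le[of x y] le[of y x] that nonneg in \<open>auto simp: min_def max_def split: if_splits\<close>)
    show "\<alpha> x * \<beta> y + \<alpha> y * \<beta> x \<le> \<gamma> x * \<delta> y + \<gamma> y * \<delta> x"
      using *[OF xy] *[OF xy(2,1)] by (cases "x \<le> y") (auto simp: add.commute)
  qed
  thus ?thesis by (simp add: sym)
qed

lemma sum_PiE_insert:
  fixes f :: "('a \<Rightarrow> 'b) \<Rightarrow> 'c::comm_monoid_add"
  assumes "i \<notin> A"
  shows "sum f (PiE (insert i A) B) = (\<Sum>x\<in>B i. \<Sum>g\<in>PiE A B. f (g(i := x)))"
proof -
  have "sum f (PiE (insert i A) B) = (\<Sum>(x, g)\<in>B i \<times> PiE A B. f (g(i := x)))"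
    unfolding PiE_insert_eq
    by (subst sum.reindex[OF inj_combinator[OF assms]]) (simp add: o_def case_prod_unfold)
  thus ?thesis by (simp add: sum.cartesian_product)
qed

text \<open>Induction on coordinates (Ahlswede-Daykin): summing out all coordinates except
  \<open>i\<close> leaves four functions on the chain \<open>K\<close>, and the induction hypothesis
  supplies the inequality that \<open>four_functions_chain\<close> asks of them.\<close>

lemma four_functions:
  fixes \<alpha> \<beta> \<gamma> \<delta> :: "('i \<Rightarrow> 'a::linorder) \<Rightarrow> real"
  assumes "finite A"
    and "\<And>x. 0 \<le> \<alpha> x" "\<And>x. 0 \<le> \<beta> x" "\<And>x. 0 \<le> \<gamma> x" "\<And>x. 0 \<le> \<delta> x"
    and "\<And>a b. a \<in> A \<rightarrow>\<^sub>E K \<Longrightarrow> b \<in> A \<rightarrow>\<^sub>E K \<Longrightarrow>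
           \<alpha> a * \<beta> b \<le> \<gamma> (\<lambda>i. min (a i) (b i)) * \<delta> (\<lambda>i. max (a i) (b i))"
  shows "sum \<alpha> (A \<rightarrow>\<^sub>E K) * sum \<beta> (A \<rightarrow>\<^sub>E K) \<le> sum \<gamma> (A \<rightarrow>\<^sub>E K) * sum \<delta> (A \<rightarrow>\<^sub>E K)"
  using assms
proof (induction A arbitrary: \<alpha> \<beta> \<gamma> \<delta> rule: finite_induct)
  case empty
  show ?case using empty(5)[of "\<lambda>_. undefined" "\<lambda>_. undefined"] by simp
next
  case (insert i A)
  show ?case unfolding sum_PiE_insert[OF insert(2)]
  proof (rule four_functions_chain)
    fix x y assume xy: "x \<in> K" "y \<in> K"
    show "(\<Sum>g\<in>A \<rightarrow>\<^sub>E K. \<alpha> (g(i := x))) * (\<Sum>g\<in>A \<rightarrow>\<^sub>E K. \<beta> (g(i := y)))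
        \<le> (\<Sum>g\<in>A \<rightarrow>\<^sub>E K. \<gamma> (g(i := min x y))) * (\<Sum>g\<in>A \<rightarrow>\<^sub>E K. \<delta> (g(i := max x y)))"
    proof (rule insert.IH)
      fix a b assume ab: "a \<in> A \<rightarrow>\<^sub>E K" "b \<in> A \<rightarrow>\<^sub>E K"
      have "(\<lambda>l. min ((a(i := x)) l) ((b(i := y)) l)) = (\<lambda>l. min (a l) (b l))(i := min x y)"
           "(\<lambda>l. max ((a(i := x)) l) ((b(i := y)) l)) = (\<lambda>l. max (a l) (b l))(i := max x y)"
        by auto
      thus "\<alpha> (a(i := x)) * \<beta> (b(i := y)) \<le> \<gamma> ((\<lambda>l. min (a l) (b l))(i := min x y))
              * \<delta> ((\<lambda>l. max (a l) (b l))(i := max x y))"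
        using insert.prems(5)[of "a(i := x)" "b(i := y)"] PiE_fun_upd[of x "\<lambda>_. K" i a A]
          PiE_fun_upd[of y "\<lambda>_. K" i b A] ab xy by (metis (no_types, lifting))
    qed (use insert.prems in auto)
  qed (auto intro!: sum_nonneg insert.prems)
qed

section \<open>The multinomial law of the path\<close>

lemma measure_bind_pmf_finite:
  assumes "finite S" "set_pmf D \<subseteq> S"
  shows "measure_pmf.prob (bind_pmf D f) E = (\<Sum>x\<in>S. pmf D x * measure_pmf.prob (f x) E)"
proof -
  have "measure_pmf.prob (bind_pmf D f) E = (\<integral>x. measure_pmf.prob (f x) E \<partial>D)"
  proof -
    have "ennreal (measure_pmf.prob (bind_pmf D f) E) = (\<integral>\<^sup>+x. ennreal (measure_pmf.prob (f x) E) \<partial>D)"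
      by (simp add: measure_pmf.emeasure_eq_measure[symmetric])
    also have "\<dots> = ennreal (\<integral>x. measure_pmf.prob (f x) E \<partial>D)"
      by (intro nn_integral_eq_integral measure_pmf.integrable_const_bound[where B=1]) auto
    finally show ?thesis by (simp add: integral_nonneg_AE)
  qed
  also have "\<dots> = (\<Sum>x\<in>S. pmf D x * measure_pmf.prob (f x) E)"
    using assms by (subst integral_measure_pmf[of S]) (auto simp: mult.commute)
  finally show ?thesis .
qed

text \<open>Multinomial formula, by induction on the balls. If the new ball falls into bin
  \<open>x\<close>, the others must realise \<open>z\<close> with one ball fewer there, which
  contributes \<open>z x\<close> times the product for \<open>z\<close>. These factors add up to the
  number of balls and complete the factorial.\<close>

lemma prob_Pi_pmf_counts:
  assumes "finite A" "finite S" "set_pmf D \<subseteq> S" "(\<Sum>i\<in>S. z i) = card A"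
  shows "measure_pmf.prob (Pi_pmf A d (\<lambda>_. D)) {T. \<forall>i\<in>S. card {j\<in>A. T j = i} = z i}
           = fact (card A) * (\<Prod>i\<in>S. pmf D i ^ z i / fact (z i))"
  using assms(1,4)
proof (induction A arbitrary: z rule: finite_induct)
  case empty
  hence "\<And>i. i \<in> S \<Longrightarrow> z i = 0" using assms(2) by simp
  thus ?case by (simp add: indicator_def)
next
  case (insert a A)
  let ?E = "{T. \<forall>i\<in>S. card {j\<in>insert a A. T j = i} = z i}"
  let ?P = "\<lambda>z. \<Prod>i\<in>S. pmf D i ^ z i / (fact (z i) :: real)"
  have upd: "card {j\<in>insert a A. (f(a := x)) j = i} = card {j\<in>A. f j = i} + (if x = i then 1 else 0)"
    for f x i
  proof -
    have "{j\<in>insert a A. (f(a := x)) j = i} = (if x = i then insert a {j\<in>A. f j = i} else {j\<in>A. f j = i})"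
      using insert(2) by auto
    thus ?thesis using insert(1,2) by simp
  qed
  have step: "pmf D x * measure_pmf.prob (Pi_pmf A d (\<lambda>_. D)) {f. f(a := x) \<in> ?E}
      = fact (card A) * (real (z x) * ?P z)" if x: "x \<in> S" for x
  proof (cases "z x")
    case 0
    have "f(a := x) \<notin> ?E" for f
      unfolding mem_Collect_eq upd using x 0 by force
    hence E: "{f. f(a := x) \<in> ?E} = {}" by blast
    show ?thesis unfolding E using 0 by simp
  next
    case (Suc m)
    have E: "{f. f(a := x) \<in> ?E} = {f. \<forall>i\<in>S. card {j\<in>A. f j = i} = (z(x := m)) i}"
      using Suc by (simp only: upd mem_Collect_eq) auto
    have "sum z S = z x + sum z (S - {x})" "sum (z(x := m)) S = m + sum z (S - {x})"
      using x assms(2) by (simp_all add: sum.remove)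
    hence "sum (z(x := m)) S = card A" using insert Suc by simp
    hence "measure_pmf.prob (Pi_pmf A d (\<lambda>_. D)) {f. f(a := x) \<in> ?E} = fact (card A) * ?P (z(x := m))"
      unfolding E by (rule insert.IH)
    moreover have "pmf D x * ?P (z(x := m)) = real (z x) * ?P z"
      using x assms(2) Suc by (simp add: prod.remove field_simps del: of_nat_Suc)
    ultimately show ?thesis by (simp add: mult_ac)
  qed
  have "measure_pmf.prob (Pi_pmf (insert a A) d (\<lambda>_. D)) ?E
      = (\<Sum>x\<in>S. pmf D x * measure_pmf.prob (Pi_pmf A d (\<lambda>_. D)) {f. f(a := x) \<in> ?E})"
    unfolding Pi_pmf_insert'[OF insert(1,2)]
    by (subst measure_bind_pmf_finite[OF assms(2,3)])
       (simp add: map_pmf_def[symmetric] vimage_def)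
  also have "\<dots> = fact (card A) * (real (\<Sum>x\<in>S. z x) * ?P z)"
    unfolding of_nat_sum sum_distrib_right sum_distrib_left by (intro sum.cong refl step)
  also have "\<dots> = fact (card (insert a A)) * ?P z"
    using insert by simp
  finally show ?case .
qed

text \<open>Restriction to \<open>{0..k}\<close> puts the paths into a finite product of chains,
  where the four functions theorem applies. The lift \<open>L\<close> allows paths at different
  heights to be compared in the same lattice.\<close>

definition bin_path :: "nat \<Rightarrow> nat \<Rightarrow> (nat \<Rightarrow> nat) \<Rightarrow> nat \<Rightarrow> nat" where
  "bin_path k L T = (\<lambda>t\<in>{0..k}. L + card {j\<in>{1..k - 1}. T j \<le> t})"

text \<open>The case distinction kills descending steps, to which truncated subtraction would give
  weight 1.\<close>

definition step_weight :: "real \<Rightarrow> nat \<Rightarrow> nat \<Rightarrow> real" where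
  "step_weight x a b = (if a \<le> b then x ^ (b - a) / fact (b - a) else 0)"

text \<open>The end values express that no ball lies before bin 1 and all \<open>k - 1\<close> balls
  lie in the first \<open>k\<close> bins. Up to the factor \<open>fact (k - 1)\<close> this is the
  multinomial law of the path.\<close>

definition path_weight :: "(nat \<Rightarrow> real) \<Rightarrow> nat \<Rightarrow> nat \<Rightarrow> (nat \<Rightarrow> nat) \<Rightarrow> real" where
  "path_weight f k L v =
     (if v 0 = L \<and> v k = L + (k - 1) then \<Prod>i\<in>{1..k}. step_weight (f i) (v (i - 1)) (v i) else 0)"

section \<open>Log-supermodularity of the path weight\<close>

lemma step_weight_nonneg: "0 \<le> x \<Longrightarrow> 0 \<le> step_weight x a b"
  by (simp add: step_weight_def)

lemma path_weight_nonneg: "(\<And>i. 0 \<le> f i) \<Longrightarrow> 0 \<le> path_weight f k L v"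
  by (simp add: path_weight_def prod_nonneg step_weight_nonneg)

text \<open>Log-convexity of the factorial: of two pairs with equal sum, the more spread out one has
  the larger product.\<close>

lemma fact_mult_fact_le: "fact (u + s) * fact (w + s) \<le> (fact (u + w + s) * fact s :: real)"
proof (induction u)
  case (Suc u)
  have "fact (Suc u + s) * fact (w + s) = real (Suc (u + s)) * (fact (u + s) * fact (w + s))"
    by (simp add: algebra_simps)
  also have "\<dots> \<le> real (Suc (u + w + s)) * (fact (u + w + s) * fact s)"
    by (intro mult_mono Suc) auto
  also have "\<dots> = fact (Suc u + w + s) * fact s" by (simp add: algebra_simps)
  finally show ?case .
qed simp

text \<open>Both sides carry the same power of \<open>x\<close>. The increments on the left,
  \<open>u + w + s\<close> and \<open>s\<close>, are more spread out than \<open>w + s\<close> and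
  \<open>u + s\<close>, so the product of their factorials is larger. If \<open>b' < a'\<close>, the
  left side vanishes.\<close>

lemma step_weight_crossing:
  assumes x: "0 \<le> x" and "a \<le> a'" "b' \<le> b"
  shows "step_weight x a b * step_weight x a' b' \<le> step_weight x a b' * step_weight x a' b"
proof (cases "a' \<le> b'")
  case True
  define u w s where "u = b - b'" and "w = a' - a" and "s = b' - a'"
  have eqs: "b - a = u + w + s" "b' - a' = s" "b' - a = w + s" "b - a' = u + s"
    using assms True by (auto simp: u_def w_def s_def)
  have "x ^ (b - a) / fact (b - a) * (x ^ (b' - a') / fact (b' - a'))
      = x ^ (u + w + 2 * s) / (fact (u + w + s) * fact s)"
    by (simp add: eqs power_add power2_eq_square power_mult mult_ac power_even_eq)
  also have "\<dots> \<le> x ^ (u + w + 2 * s) / (fact (u + s) * fact (w + s))"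
    by (intro divide_left_mono fact_mult_fact_le) (use x in auto)
  also have "\<dots> = x ^ (b' - a) / fact (b' - a) * (x ^ (b - a') / fact (b - a'))"
    by (simp add: eqs power_add power2_eq_square power_mult mult_ac power_even_eq)
  finally show ?thesis using assms True by (simp add: step_weight_def)
qed (use x in \<open>auto simp: step_weight_def\<close>)

lemma step_weight_supermodular:
  assumes "0 \<le> x"
  shows "step_weight x a b * step_weight x a' b'
    \<le> step_weight x (min a a') (min b b') * step_weight x (max a a') (max b b')"
  using step_weight_crossing[OF assms, of a a' b' b] step_weight_crossing[OF assms, of a' a b b']
  by (cases "a \<le> a'"; cases "b \<le> b'") (auto simp: min_def max_def mult.commute)

text \<open>Since \<open>L \<le> L'\<close>, the minimum has the end values prescribed for
  \<open>L\<close> and the maximum those for \<open>L'\<close>. The products can then be compared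
  step by step.\<close>

lemma path_weight_supermodular:
  assumes f: "\<And>i. 0 \<le> f i" and "L \<le> L'"
  shows "path_weight f k L a * path_weight f k L' b
    \<le> path_weight f k L (\<lambda>i. min (a i) (b i)) * path_weight f k L' (\<lambda>i. max (a i) (b i))"
proof (cases "a 0 = L \<and> a k = L + (k - 1) \<and> b 0 = L' \<and> b k = L' + (k - 1)")
  case True
  thus ?thesis using assms
    by (auto simp: path_weight_def prod.distrib[symmetric]
        intro!: prod_mono step_weight_supermodular mult_nonneg_nonneg step_weight_nonneg)
next
  case False
  hence "path_weight f k L a * path_weight f k L' b = 0" by (auto simp: path_weight_def)
  also have "0 \<le> path_weight f k L (\<lambda>i. min (a i) (b i)) * path_weight f k L' (\<lambda>i. max (a i) (b i))"
    by (simp add: path_weight_nonneg f)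
  finally show ?thesis .
qed

text \<open>The bin counts are the increments of the path, so its law is multinomial. If
  \<open>v\<close> is not monotone between the prescribed end values, both sides vanish.\<close>

lemma prob_bin_path_eq:
  assumes D: "set_pmf D \<subseteq> {1..k}" and v: "v \<in> extensional {0..k}"
  shows "measure_pmf.prob (Pi_pmf {1..k - 1} 0 (\<lambda>_. D)) {T. bin_path k L T = v}
     = fact (k - 1) * path_weight (pmf D) k L v"
proof -
  let ?P = "Pi_pmf {1..k - 1} 0 (\<lambda>_. D)"
  let ?N = "\<lambda>T (t::nat). card {j\<in>{1..k - 1}. T j \<le> t}"
  have supp: "T j \<in> {1..k}" if "T \<in> set_pmf ?P" "j \<in> {1..k - 1}" for T j
    using that D by (auto simp: set_Pi_pmf PiE_dflt_def)
  have N0: "?N T 0 = 0" if "T \<in> set_pmf ?P" for T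
    using supp[OF that] by fastforce
  have Nk: "?N T k = k - 1" if "T \<in> set_pmf ?P" for T
  proof -
    have "{j\<in>{1..k - 1}. T j \<le> k} = {1..k - 1}" using supp[OF that] by auto
    thus ?thesis by simp
  qed
  have NS: "?N T i = ?N T (i - 1) + card {j\<in>{1..k - 1}. T j = i}" if "1 \<le> i" for T and i :: nat
  proof -
    have eq: "{j\<in>{1..k - 1}. T j \<le> i} = {j\<in>{1..k - 1}. T j \<le> i - 1} \<union> {j\<in>{1..k - 1}. T j = i}"
      using that by auto
    show ?thesis unfolding eq by (rule card_Un_disjoint) (use that in auto)
  qed
  show ?thesis
  proof (cases "v 0 = L \<and> v k = L + (k - 1) \<and> (\<forall>i\<in>{1..k}. v (i - 1) \<le> v i)")
    case True
    define z where "z i = v i - v (i - 1)" for i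
    have vz: "v i = L + (\<Sum>l=1..i. z l)" if "i \<le> k" for i
      using that
    proof (induction i)
      case (Suc i)
      have "Suc i \<in> {1..k}" using Suc.prems by simp
      hence "v (Suc i - 1) \<le> v (Suc i)" using True by blast
      thus ?case using Suc.IH Suc.prems by (simp add: z_def)
    next
      case 0
      have "v 0 = L" using True by blast
      thus ?case by simp
    qed
    have sumz: "(\<Sum>i\<in>{1..k}. z i) = card {1..k - 1}" using vz[OF order.refl] conjunct1[OF conjunct2[OF True]] by simp
    have "measure_pmf.prob ?P {T. bin_path k L T = v}
        = measure_pmf.prob ?P {T. \<forall>i\<in>{1..k}. card {j\<in>{1..k - 1}. T j = i} = z i}"
    \<comment> \<open>The two events agree only on the support: a ball at 0 would enter every count
      \<open>T j \<le> t\<close> but no bin of \<open>{1..k}\<close>.\<close>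
    proof (rule measure_prob_cong_0; rule pmf_eq_0_set_pmf[THEN iffD2]; rule notI)
      fix T assume T: "T \<in> {T. bin_path k L T = v} - {T. \<forall>i\<in>{1..k}. card {j\<in>{1..k - 1}. T j = i} = z i}"
      have v: "v t = L + ?N T t" if "t \<le> k" for t using T that by (auto simp: bin_path_def)
      have "z i = card {j\<in>{1..k - 1}. T j = i}" if "i \<in> {1..k}" for i
      proof -
        have "i - 1 \<le> k" "1 \<le> i" "i \<le> k" using that by auto
        thus ?thesis using NS[of i T] v[of i] v[of "i - 1"] by (simp add: z_def)
      qed
      thus False using T by auto
    next
      fix T assume T: "T \<in> {T. \<forall>i\<in>{1..k}. card {j\<in>{1..k - 1}. T j = i} = z i} - {T. bin_path k L T = v}"
        and Ts: "T \<in> set_pmf ?P"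
      have "?N T i = (\<Sum>l=1..i. z l)" if "i \<le> k" for i
        using that
      proof (induction i)
        case (Suc i) thus ?case using NS[of "Suc i" T] T by auto
      qed (simp only: N0[OF Ts], simp)
      hence "bin_path k L T = v" using v vz
        by (intro extensionalityI[of _ "{0..k}"]) (auto simp: bin_path_def)
      thus False using T by auto
    qed
    also have "\<dots> = fact (k - 1) * (\<Prod>i\<in>{1..k}. pmf D i ^ z i / fact (z i))"
      using prob_Pi_pmf_counts[OF _ _ D sumz, of 0] by simp
    also have "\<dots> = fact (k - 1) * path_weight (pmf D) k L v"
      using True by (simp add: path_weight_def step_weight_def z_def)
    finally show ?thesis .
  next
    case False
    hence "path_weight (pmf D) k L v = 0"
      by (auto simp: path_weight_def step_weight_def prod_zero_iff)
    moreover have "bin_path k L T \<noteq> v" if "T \<in> set_pmf ?P" for T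
    proof
      assume eq: "bin_path k L T = v"
      have v: "v t = L + ?N T t" if "t \<le> k" for t using eq that by (auto simp: bin_path_def)
      have "v (i - 1) \<le> v i" if "i \<in> {1..k}" for i
        using that by (subst (1 2) v) (auto intro!: card_mono)
      moreover have "v 0 = L" "v k = L + (k - 1)"
        unfolding v[OF le0] v[OF order.refl] N0[OF that] Nk[OF that] by auto
      ultimately show False using False by blast
    qed
    hence "measure_pmf.prob ?P {T. bin_path k L T = v} = measure_pmf.prob ?P {}"
      by (intro measure_prob_cong_0) (auto simp: pmf_eq_0_set_pmf)
    ultimately show ?thesis by simp
  qed
qed

text \<open>The bound \<open>K\<close> is left free so that paths with different lifts can be summed
  over one common box.\<close>

lemma prob_bin_path_sum:
  assumes D: "set_pmf D \<subseteq> {1..k}" and K: "L + k \<le> K"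
  shows "measure_pmf.prob (Pi_pmf {1..k - 1} 0 (\<lambda>_. D)) {T. bin_path k L T \<in> C}
     = fact (k - 1) * (\<Sum>v\<in>{0..k} \<rightarrow>\<^sub>E {..K}. path_weight (pmf D) k L v * indicator C v)"
proof -
  let ?P = "Pi_pmf {1..k - 1} 0 (\<lambda>_. D)"
  let ?V = "{0..k} \<rightarrow>\<^sub>E {..K}"
  have "card {j\<in>{1..k - 1}. T j \<le> t} \<le> k - 1" for T :: "nat \<Rightarrow> nat" and t
    by (rule order.trans[OF card_mono[of "{1..k - 1}"]]) auto
  hence "L + card {j\<in>{1..k - 1}. T j \<le> t} \<le> K" for T :: "nat \<Rightarrow> nat" and t
    using K by (meson add_left_mono diff_le_self le_trans)
  hence "bin_path k L T \<in> ?V" for T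
    by (auto simp: bin_path_def)
  hence "{T. bin_path k L T \<in> C} = (\<Union>v\<in>?V \<inter> C. {T. bin_path k L T = v})" by auto
  hence "measure_pmf.prob ?P {T. bin_path k L T \<in> C}
      = (\<Sum>v\<in>?V \<inter> C. measure_pmf.prob ?P {T. bin_path k L T = v})"
    by (simp only:, subst measure_pmf.finite_measure_finite_Union)
       (auto simp: finite_PiE disjoint_family_on_def)
  also have "\<dots> = (\<Sum>v\<in>?V \<inter> C. fact (k - 1) * path_weight (pmf D) k L v)"
    by (intro sum.cong refl prob_bin_path_eq[OF D]) (auto simp: PiE_def)
  also have "\<dots> = fact (k - 1) * (\<Sum>v\<in>?V. path_weight (pmf D) k L v * indicator C v)"
    by (simp add: sum_distrib_left sum.inter_restrict finite_PiE indicator_def if_distrib cong: if_cong)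
  finally show ?thesis .
qed

text \<open>Holley-type comparison, tested on an increasing event \<open>U\<close>: the path lifted
  by \<open>L\<close> and conditioned on \<open>C'\<close> dominates the unlifted path conditioned
  on \<open>C\<close>. It is the four functions theorem for the path weights times indicators,
  stated with products in place of conditional probabilities.\<close>

lemma bin_path_holley:
  fixes C C' U :: "(nat \<Rightarrow> nat) set"
  assumes D: "set_pmf D \<subseteq> {1..k}"
    and C: "\<And>a b. a \<in> C \<Longrightarrow> b \<in> C' \<Longrightarrow> (\<lambda>i. min (a i) (b i)) \<in> C"
    and C': "\<And>a b. a \<in> C \<Longrightarrow> b \<in> C' \<Longrightarrow> (\<lambda>i. max (a i) (b i)) \<in> C'"
    and U: "\<And>a b. a \<in> U \<Longrightarrow> (\<lambda>i. max (a i) (b i)) \<in> U"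
  defines "P \<equiv> measure_pmf.prob (Pi_pmf {1..k - 1} 0 (\<lambda>_. D))"
  shows "P {T. bin_path k 0 T \<in> C \<inter> U} * P {T. bin_path k L T \<in> C'}
    \<le> P {T. bin_path k 0 T \<in> C} * P {T. bin_path k L T \<in> C' \<inter> U}"
proof -
  let ?w = "path_weight (pmf D) k"
  let ?S = "\<lambda>l A. \<Sum>v\<in>{0..k} \<rightarrow>\<^sub>E {..L + k}. ?w l v * indicator A v"
  have S: "P {T. bin_path k l T \<in> A} = fact (k - 1) * ?S l A"
    if "l \<le> L" for l A
    unfolding P_def by (rule prob_bin_path_sum[OF D]) (use that in auto)
  have "?S 0 (C \<inter> U) * ?S L C' \<le> ?S 0 C * ?S L (C' \<inter> U)"
  proof (rule four_functions)
    fix a b :: "nat \<Rightarrow> nat"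
    show "?w 0 a * indicator (C \<inter> U) a * (?w L b * indicator C' b)
      \<le> ?w 0 (\<lambda>i. min (a i) (b i)) * indicator C (\<lambda>i. min (a i) (b i))
        * (?w L (\<lambda>i. max (a i) (b i)) * indicator (C' \<inter> U) (\<lambda>i. max (a i) (b i)))"
    proof (cases "a \<in> C \<inter> U \<and> b \<in> C'")
      case True
      thus ?thesis using path_weight_supermodular[of "pmf D" 0 L k a b] C C' U
        by (simp add: indicator_def)
    qed (auto simp: indicator_def path_weight_nonneg)
  qed (auto simp: path_weight_nonneg)
  hence "(fact (k - 1) * fact (k - 1)) * (?S 0 (C \<inter> U) * ?S L C') \<le> (fact (k - 1) * fact (k - 1)) * (?S 0 C * ?S L (C' \<inter> U))"
    by (rule mult_left_mono) simp
  thus ?thesis unfolding S[OF le0] S[OF order.refl] by (simp only: mult_ac)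
qed

section \<open>Domination of the conditioned variable\<close>

lemma card_le_Suc_eq:
  fixes T :: "'a \<Rightarrow> nat"
  assumes "finite A"
  shows "card {j\<in>A. T j \<le> Suc i} = card {j\<in>A. T j \<le> i} + card {j\<in>A. T j = Suc i}"
proof -
  have eq: "{j\<in>A. T j \<le> Suc i} = {j\<in>A. T j \<le> i} \<union> {j\<in>A. T j = Suc i}" by auto
  show ?thesis unfolding eq by (rule card_Un_disjoint) (use assms in auto)
qed

lemma set_balls_pmf:
  assumes "0 < p" "p < 1" "1 \<le> k" "T \<in> set_pmf (balls_pmf k p)" "j \<in> {1..k - 1}"
  shows "1 \<le> T j" "T j \<le> k"
proof -
  have "T j \<in> {1..k}"
    using assms set_bin_pmf[OF assms(1-3)] by (auto simp: balls_pmf_def set_Pi_pmf PiE_dflt_def)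
  thus "1 \<le> T j" "T j \<le> k" by auto
qed

lemma Y_eq:
  assumes "\<And>j. j \<in> {1..k - 1} \<Longrightarrow> 1 \<le> T j"
  shows "Y k T t = 1 + int (card {j\<in>{1..k - 1}. T j \<le> t}) - int t"
proof (induction t)
  case 0
  have none: "{j\<in>{1..k - 1}. T j \<le> 0} = {}" using assms by fastforce
  show ?case unfolding none by simp
next
  case (Suc t)
  show ?case using Suc card_le_Suc_eq[of "{1..k - 1}" T t] by (simp add: Z_def)
qed

text \<open>Each \<open>T j\<close> is \<open>k\<close> minus the number of \<open>t\<close> in
  \<open>{1..k - 1}\<close> with \<open>T j \<le> t\<close>. Exchanging the sums over balls and bins
  turns \<open>M\<close> into an area under the path, hence into an increasing function of the
  path.\<close>

lemma M_eq:
  assumes T: "\<And>j. j \<in> {1..k - 1} \<Longrightarrow> 1 \<le> T j" "\<And>j. j \<in> {1..k - 1} \<Longrightarrow> T j \<le> k"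
  shows "M k T = (\<Sum>t=1..k - 1. real (card {j\<in>{1..k - 1}. T j \<le> t})) - real (k choose 2)"
proof -
  have "real (T j) = real k - (\<Sum>t=1..k - 1. if T j \<le> t then 1 else 0)" if "j \<in> {1..k - 1}" for j
  proof -
    have "(\<Sum>t=1..k - 1. if T j \<le> t then 1 else (0::real)) = real (card ({1..k - 1} \<inter> {t. T j \<le> t}))"
      by (simp add: sum.If_cases)
    also have "{1..k - 1} \<inter> {t. T j \<le> t} = {T j..<k}" using T(1)[OF that] that by auto
    finally show ?thesis using T(2)[OF that] by simp
  qed
  hence "(\<Sum>j=1..k - 1. real (T j)) = (\<Sum>j=1..k - 1. real k - (\<Sum>t=1..k - 1. if T j \<le> t then 1 else 0))"
    by (intro sum.cong) auto
  also have "\<dots> = real (k - 1) * real k - (\<Sum>t=1..k - 1. \<Sum>j=1..k - 1. if T j \<le> t then 1 else 0)"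
    unfolding sum_subtractf by (subst (2) sum.swap) simp
  also have "\<dots> = real (k - 1) * real k - (\<Sum>t=1..k - 1. real (card {j\<in>{1..k - 1}. T j \<le> t}))"
    by (simp add: sum.If_cases Int_def)
  finally have "(\<Sum>j=1..k - 1. real (T j)) = real (k * (k - 1)) - (\<Sum>t=1..k - 1. real (card {j\<in>{1..k - 1}. T j \<le> t}))"
    by simp
  moreover have "real (k * (k - 1)) = 2 * real (k choose 2)"
  proof -
    have "even (k * (k - 1))" by (cases k) auto
    hence "k * (k - 1) = 2 * (k choose 2)" unfolding choose_two by simp
    thus ?thesis by simp
  qed
  ultimately show ?thesis by (simp add: M_def)
qed

context
  fixes k :: nat and p :: real
  assumes p: "0 < p" "p < 1" and k: "1 \<le> k"
begin

abbreviation (input) balls_prob where "balls_prob \<equiv> measure_pmf.prob (balls_pmf k p)"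

lemma prob_bin_path_cong:
  assumes "\<And>T. \<forall>j\<in>{1..k - 1}. 1 \<le> T j \<and> T j \<le> k \<Longrightarrow>
    bin_path k L T \<in> C \<longleftrightarrow> T \<in> E"
  shows "measure_pmf.prob (Pi_pmf {1..k - 1} 0 (\<lambda>_. bin_pmf k p)) {T. bin_path k L T \<in> C} = balls_prob E"
  unfolding balls_pmf_def[symmetric]
proof -
  have "bin_path k L T \<in> C \<longleftrightarrow> T \<in> E" if "T \<in> set_pmf (balls_pmf k p)" for T
    by (rule assms) (use set_balls_pmf[OF p k that] in blast)
  thus "balls_prob {T. bin_path k L T \<in> C} = balls_prob E"
    by (intro measure_prob_cong_0) (auto simp: pmf_eq_0_set_pmf)
qed

text \<open>Both are instances of \<open>bin_path_holley\<close> in which \<open>U\<close> says that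
  the area under the path exceeds a level. The first compares no conditioning with
  \<open>TREE\<close>; the second compares \<open>TREE\<close> with the same barrier for the lifted
  path.\<close>

lemma
  shows prob_M_mult_TREE_le: "balls_prob {T. M k T > x} * balls_prob (TREE k) \<le> balls_prob (TREE k \<inter> {T. M k T > x})"
    and prob_TREE_M_shift_le: "balls_prob (TREE k \<inter> {T. M k T > x}) * balls_prob {T. \<forall>t\<in>{1..k - 1}. Y k T t > - int L}
          \<le> balls_prob (TREE k) * balls_prob {T. M k T > x - real L * real (k - 1)}"
proof -
  \<comment> \<open>One barrier serves both heights: as \<open>Y k T t\<close> is
    \<open>1 - t\<close> plus the number of balls up to bin \<open>t\<close>, it means
    \<open>TREE\<close> for the unlifted path and \<open>Y k T t > - L\<close> for the path lifted
    by \<open>L\<close>.\<close>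
  define C where "C = {v :: nat \<Rightarrow> nat. \<forall>t\<in>{1..k - 1}. t \<le> v t}"
  define U where "U = {v :: nat \<Rightarrow> nat. (\<Sum>t=1..k - 1. real (v t)) > x + real (k choose 2)}"
  let ?P = "\<lambda>L C. measure_pmf.prob (Pi_pmf {1..k - 1} 0 (\<lambda>_. bin_pmf k p)) {T. bin_path k L T \<in> C}"
  have D: "set_pmf (bin_pmf k p) \<subseteq> {1..k}" using set_bin_pmf[OF p k] by simp
  have C1: "(\<lambda>i. min (a i) (b i)) \<in> C" if "a \<in> C" "b \<in> C" for a b using that by (auto simp: C_def)
  have C2: "(\<lambda>i. max (a i) (b i)) \<in> C" if "b \<in> C" for a b using that by (fastforce simp: C_def)
  have U1: "(\<lambda>i. max (a i) (b i)) \<in> U" if "a \<in> U" for a b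
  proof -
    have "(\<Sum>t=1..k - 1. real (a t)) \<le> (\<Sum>t=1..k - 1. real (max (a t) (b t)))" by (intro sum_mono) auto
    thus ?thesis using that by (auto simp: U_def)
  qed
  have path: "bin_path k L T t = L + card {j\<in>{1..k - 1}. T j \<le> t}" if "t \<in> {1..k - 1}" for L T t
    using that by (auto simp: bin_path_def)
  have memC: "bin_path k L T \<in> C \<longleftrightarrow> (\<forall>t\<in>{1..k - 1}. Y k T t > - int L)"
    if T: "\<forall>j\<in>{1..k - 1}. 1 \<le> T j \<and> T j \<le> k" for L T
  proof -
    have "t \<le> bin_path k L T t \<longleftrightarrow> Y k T t > - int L" if "t \<in> {1..k - 1}" for t
    proof -
      have "Y k T t = 1 + int (card {j\<in>{1..k - 1}. T j \<le> t}) - int t"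
        by (rule Y_eq) (use T in blast)
      thus ?thesis unfolding path[OF that] by linarith
    qed
    thus ?thesis by (auto simp: C_def)
  qed
  have memT: "bin_path k 0 T \<in> C \<longleftrightarrow> T \<in> TREE k"
    if "\<forall>j\<in>{1..k - 1}. 1 \<le> T j \<and> T j \<le> k" for T
    using memC[OF that, of 0] by (simp add: TREE_def)
  have memU: "bin_path k L T \<in> U \<longleftrightarrow> M k T > x - real L * real (k - 1)"
    if T: "\<forall>j\<in>{1..k - 1}. 1 \<le> T j \<and> T j \<le> k" for L T
  proof -
    have "(\<Sum>t=1..k - 1. real (bin_path k L T t)) = (\<Sum>t=1..k - 1. real L + real (card {j\<in>{1..k - 1}. T j \<le> t}))"
      by (intro sum.cong refl) (simp only: path of_nat_add)
    also have "\<dots> = real (k - 1) * real L + M k T + real (k choose 2)"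
    proof -
      have "M k T = (\<Sum>t=1..k - 1. real (card {j\<in>{1..k - 1}. T j \<le> t})) - real (k choose 2)"
        by (rule M_eq) (use T in blast)+
      thus ?thesis by (simp add: sum.distrib)
    qed
    finally show ?thesis by (auto simp: U_def algebra_simps)
  qed
  note holley = bin_path_holley[OF D, of _ _ U]
  \<comment> \<open>With no condition on the lower path this is positive correlation of two
    increasing events.\<close>
  have "?P 0 (UNIV \<inter> U) * ?P 0 C \<le> ?P 0 UNIV * ?P 0 (C \<inter> U)"
    by (rule holley) (use C2 U1 in auto)
  moreover have "?P 0 (UNIV \<inter> U) = balls_prob {T. M k T > x}"
    by (rule prob_bin_path_cong) (simp add: memU[where L = 0])
  moreover have "?P 0 C = balls_prob (TREE k)"
    by (rule prob_bin_path_cong) (simp add: memT)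
  moreover have "?P 0 (C \<inter> U) = balls_prob (TREE k \<inter> {T. M k T > x})"
    by (rule prob_bin_path_cong) (simp add: memT memU[where L = 0])
  ultimately show "balls_prob {T. M k T > x} * balls_prob (TREE k) \<le> balls_prob (TREE k \<inter> {T. M k T > x})"
    by simp
  have "?P 0 (C \<inter> U) * ?P L C \<le> ?P 0 C * ?P L (C \<inter> U)"
    by (rule holley) (use C1 C2 U1 in auto)
  \<comment> \<open>Dropping the barrier for the lifted path leaves an unconditioned
    \<open>M\<close>, shifted by the \<open>L * (k - 1)\<close> that the lift adds to the
    area.\<close>
  also have "\<dots> \<le> ?P 0 C * ?P L U"
    by (intro mult_left_mono measure_pmf.finite_measure_mono) auto
  also have "?P L U = balls_prob {T. M k T > x - real L * real (k - 1)}"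
    by (rule prob_bin_path_cong) (simp add: memU)
  also have "?P L C = balls_prob {T. \<forall>t\<in>{1..k - 1}. Y k T t > - int L}"
    by (rule prob_bin_path_cong) (simp add: memC)
  also have "?P 0 C = balls_prob (TREE k)"
    by (rule prob_bin_path_cong) (simp add: memT)
  also have "?P 0 (C \<inter> U) = balls_prob (TREE k \<inter> {T. M k T > x})"
    by (rule prob_bin_path_cong) (simp add: memT memU[where L = 0])
  finally show "balls_prob (TREE k \<inter> {T. M k T > x}) * balls_prob {T. \<forall>t\<in>{1..k - 1}. Y k T t > - int L}
          \<le> balls_prob (TREE k) * balls_prob {T. M k T > x - real L * real (k - 1)}" .
qed

lemma prob_M_star:
  "measure_pmf.prob (M_star_pmf k p) {x. x > y} * balls_prob (TREE k) = balls_prob (TREE k \<inter> {T. M k T > y})"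
proof -
  note ne = balls_pmf_TREE_nonempty[OF p k]
  have pos: "balls_prob (TREE k) \<noteq> 0" using ne by (simp add: measure_pmf_zero_iff)
  have "measure_pmf.prob (cond_pmf (balls_pmf k p) (TREE k)) E = balls_prob (TREE k \<inter> E) / balls_prob (TREE k)" for E
    unfolding cond_pmf.rep_eq[OF ne] using pos
    by (subst measure_uniform_measure) (auto simp: measure_pmf.emeasure_eq_measure)
  thus ?thesis using pos by (simp add: M_star_pmf_def vimage_def)
qed

end

section \<open>Hitting probabilities\<close>

lemma expectation_Pi_pmf_insert:
  fixes h :: "_ \<Rightarrow> real"
  assumes "finite A" "a \<notin> A" and D: "finite (set_pmf D)"
  shows "measure_pmf.expectation (Pi_pmf (insert a A) d (\<lambda>_. D)) h
    = measure_pmf.expectation D (\<lambda>x. measure_pmf.expectation (Pi_pmf A d (\<lambda>_. D)) (\<lambda>T. h (T(a := x))))"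
proof -
  have fin: "finite (set_pmf (Pi_pmf A d (\<lambda>_. D)))"
    using assms by (simp add: set_Pi_pmf finite_PiE_dflt)
  have "measure_pmf.expectation (Pi_pmf (insert a A) d (\<lambda>_. D)) h
      = (\<Sum>x\<in>set_pmf D. pmf D x *\<^sub>R measure_pmf.expectation (map_pmf (\<lambda>T. T(a := x)) (Pi_pmf A d (\<lambda>_. D))) h)"
    unfolding Pi_pmf_insert'[OF assms(1,2)] map_pmf_def[symmetric]
    by (rule pmf_expectation_bind) (use D fin in auto)
  also have "\<dots> = (\<Sum>x\<in>set_pmf D. pmf D x *\<^sub>R measure_pmf.expectation (Pi_pmf A d (\<lambda>_. D)) (\<lambda>T. h (T(a := x))))"
    by simp
  also have "\<dots> = measure_pmf.expectation D (\<lambda>x. measure_pmf.expectation (Pi_pmf A d (\<lambda>_. D)) (\<lambda>T. h (T(a := x))))"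
    by (rule integral_measure_pmf[OF D, symmetric])
  finally show ?thesis .
qed

text \<open>Martingale property of the likelihood ratio: \<open>\<Phi>\<close> sees a ball only
  through its position inside \<open>I\<close>, so with the other balls fixed \<open>ww'\<close>
  exchanges the weight of one ball. The induction exchanges them one at a time.\<close>

lemma Pi_pmf_likelihood_cong:
  fixes w w' :: "'b \<Rightarrow> real" and \<Phi> :: "('a \<Rightarrow> 'b) \<Rightarrow> real"
  assumes "finite A" and D: "finite (set_pmf D)"
    and ww': "\<And>h. (\<And>x y. x \<notin> I \<Longrightarrow> y \<notin> I \<Longrightarrow> h x = h y) \<Longrightarrow>
                measure_pmf.expectation D (\<lambda>x. w x * h x) = measure_pmf.expectation D (\<lambda>x. w' x * h x)"
    and "\<And>T T'. (\<And>j. j \<in> A \<Longrightarrow> T j = T' j \<or> T j \<notin> I \<and> T' j \<notin> I) \<Longrightarrow> \<Phi> T = \<Phi> T'"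
  shows "measure_pmf.expectation (Pi_pmf A d (\<lambda>_. D)) (\<lambda>T. (\<Prod>j\<in>A. w (T j)) * \<Phi> T)
       = measure_pmf.expectation (Pi_pmf A d (\<lambda>_. D)) (\<lambda>T. (\<Prod>j\<in>A. w' (T j)) * \<Phi> T)"
  using assms(1,4)
proof (induction A arbitrary: \<Phi> rule: finite_induct)
  case (insert a A)
  let ?P = "Pi_pmf A d (\<lambda>_. D)"
  have split: "measure_pmf.expectation (Pi_pmf (insert a A) d (\<lambda>_. D)) (\<lambda>T. (\<Prod>j\<in>insert a A. u (T j)) * \<Phi> T)
     = measure_pmf.expectation D (\<lambda>x. u x * measure_pmf.expectation ?P (\<lambda>T. (\<Prod>j\<in>A. u (T j)) * \<Phi> (T(a := x))))"
    for u :: "'b \<Rightarrow> real"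
  proof -
    have prod: "(\<Prod>j\<in>insert a A. u ((T(a := x)) j)) = u x * (\<Prod>j\<in>A. u (T j))" for T x
    proof -
      have "(\<Prod>j\<in>A. u ((T(a := x)) j)) = (\<Prod>j\<in>A. u (T j))"
        using insert(2) by (intro prod.cong) auto
      thus ?thesis using insert(1,2) by simp
    qed
    show ?thesis
      unfolding expectation_Pi_pmf_insert[OF insert(1,2) D] prod mult.assoc by simp
  qed
  have IH: "measure_pmf.expectation ?P (\<lambda>T. (\<Prod>j\<in>A. w (T j)) * \<Phi> (T(a := x)))
     = measure_pmf.expectation ?P (\<lambda>T. (\<Prod>j\<in>A. w' (T j)) * \<Phi> (T(a := x)))" for x
  proof (rule insert.IH)
    fix T T' assume *: "\<And>j. j \<in> A \<Longrightarrow> T j = T' j \<or> T j \<notin> I \<and> T' j \<notin> I"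
    show "\<Phi> (T(a := x)) = \<Phi> (T'(a := x))"
      by (rule insert.prems) (use * in \<open>auto split: if_splits\<close>)
  qed
  have inv: "\<Phi> (T(a := x)) = \<Phi> (T(a := y))" if "x \<notin> I" "y \<notin> I" for T x y
    using that by (intro insert.prems) auto
  have "measure_pmf.expectation D (\<lambda>x. w x * measure_pmf.expectation ?P (\<lambda>T. (\<Prod>j\<in>A. w' (T j)) * \<Phi> (T(a := x))))
     = measure_pmf.expectation D (\<lambda>x. w' x * measure_pmf.expectation ?P (\<lambda>T. (\<Prod>j\<in>A. w' (T j)) * \<Phi> (T(a := x))))"
    by (rule ww', rule Bochner_Integration.integral_cong[OF refl]) (rule arg_cong[OF inv])
  thus ?case by (simp only: split IH)
qed simp

lemma expectation_two_valued:
  fixes h :: "'b \<Rightarrow> real"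
  assumes D: "finite (set_pmf D)" and h: "\<And>x. x \<notin> I \<Longrightarrow> h x = c"
  shows "measure_pmf.expectation D h
       = measure_pmf.expectation D (\<lambda>x. h x * indicator I x) + c * (1 - measure_pmf.prob D I)"
proof -
  have int: "integrable D f" for f :: "'b \<Rightarrow> real"
    using D by (rule integrable_measure_pmf_finite)
  have "measure_pmf.expectation D h
      = measure_pmf.expectation D (\<lambda>x. h x * indicator I x + c * (1 - indicator I x))"
    using h by (intro Bochner_Integration.integral_cong) (auto simp: indicator_def)
  also have "\<dots> = measure_pmf.expectation D (\<lambda>x. h x * indicator I x) + c * (1 - measure_pmf.prob D I)"
    by (subst Bochner_Integration.integral_add[OF int int]) (simp add: int)
  finally show ?thesis .
qed

text \<open>
  \<open>\<rho> ^ N\<^sub>t * \<kappa>\<^sub>t ^ (n - N\<^sub>t)\<close>, with \<open>N\<^sub>t\<close> the number of balls in \<open>I t\<close>, is the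
  likelihood ratio process of the product measure in which the mass of \<open>I m\<close> is rescaled by \<open>\<rho>\<close>.\<close>

lemma prob_hitting_le:
  fixes I :: "nat \<Rightarrow> 'b set" and C :: "nat \<Rightarrow> nat set"
  assumes A: "finite A" and D: "finite (set_pmf D)" and I: "mono I"
    and \<rho>: "0 < \<rho>" and F1: "measure_pmf.prob D (I m) < 1" and \<rho>F: "\<rho> * measure_pmf.prob D (I m) \<le> 1"
    and b: "\<And>t N. t \<in> {1..m} \<Longrightarrow> N \<in> C t \<Longrightarrow> N \<le> card A \<Longrightarrow>
      b \<le> \<rho> ^ N * ((1 - \<rho> * measure_pmf.prob D (I t)) / (1 - measure_pmf.prob D (I t))) ^ (card A - N)"
  shows "b * measure_pmf.prob (Pi_pmf A d (\<lambda>_. D)) {T. \<exists>t\<in>{1..m}. card {j\<in>A. T j \<in> I t} \<in> C t} \<le> 1"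
proof -
  let ?P = "Pi_pmf A d (\<lambda>_. D)"
  let ?E = "measure_pmf.expectation ?P"
  let ?F = "\<lambda>t. measure_pmf.prob D (I t)"
  \<comment> \<open>This value gives \<open>w t\<close> mean 1 under \<open>D\<close> for
    \<open>t \<le> m\<close>, so that \<open>G t\<close> is a probability density.\<close>
  define \<kappa> where "\<kappa> t = (1 - \<rho> * ?F t) / (1 - ?F t)" for t
  define w where "w t x = (if x \<in> I t then \<rho> else \<kappa> t)" for t x
  define N where "N t T = card {j\<in>A. T j \<in> I t}" for t T
  define G where "G t T = (\<Prod>j\<in>A. w t (T j))" for t T
  \<comment> \<open>The event that the first hit occurs at time \<open>t\<close>.\<close>
  define H where "H t = {T. N t T \<in> C t \<and> (\<forall>s\<in>{1..<t}. N s T \<notin> C s)}" for t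
  have fin: "finite (set_pmf ?P)"
    using A D by (simp add: set_Pi_pmf finite_PiE_dflt)
  have int: "integrable ?P f" for f :: "_ \<Rightarrow> real"
    using fin by (rule integrable_measure_pmf_finite)
  have Fmono: "?F s \<le> ?F t" if "s \<le> t" for s t
    using monoD[OF I that] by (intro measure_pmf.finite_measure_mono) auto
  have \<kappa>0: "0 \<le> \<kappa> t" if "t \<le> m" for t
  proof -
    have "\<rho> * ?F t \<le> 1" using mult_left_mono[OF Fmono[OF that], of \<rho>] \<rho> \<rho>F by linarith
    thus ?thesis using Fmono[OF that] F1 by (simp add: \<kappa>_def)
  qed
  have G0: "0 \<le> G t T" if "t \<le> m" for t T
    using \<rho> \<kappa>0[OF that] by (auto simp: G_def w_def intro!: prod_nonneg)
  have G_eq: "G t T = \<rho> ^ N t T * \<kappa> t ^ (card A - N t T)" for t T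
  proof -
    have "G t T = (\<Prod>j\<in>A. if T j \<in> I t then \<rho> else \<kappa> t)" by (simp add: G_def w_def)
    also have "\<dots> = (\<Prod>j\<in>{j\<in>A. T j \<in> I t}. \<rho>) * (\<Prod>j\<in>A - {j\<in>A. T j \<in> I t}. \<kappa> t)"
      using A by (subst prod.If_cases)
        (auto intro!: arg_cong2[where f = "(*)"] arg_cong2[where f = "(^)"] arg_cong[where f = card])
    also have "\<dots> = \<rho> ^ N t T * \<kappa> t ^ (card A - N t T)"
      unfolding prod_constant N_def using A by (subst card_Diff_subset) auto
    finally show ?thesis .
  qed
  have Ew: "measure_pmf.expectation D (w t) = 1" if "t \<le> m" for t
  proof -
    have "measure_pmf.expectation D (w t) = measure_pmf.expectation D (\<lambda>x. w t x * indicator (I t) x) + \<kappa> t * (1 - ?F t)"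
      by (rule expectation_two_valued[OF D]) (simp add: w_def)
    also have "(\<lambda>x. w t x * indicator (I t) x) = (\<lambda>x. \<rho> * indicator (I t) x)"
      by (auto simp: w_def indicator_def)
    finally show ?thesis using Fmono[OF that] F1 by (simp add: \<kappa>_def)
  qed
  \<comment> \<open>Optional stopping: whether the first hit occurs at \<open>t\<close> depends only
    on positions inside \<open>I t\<close>, so on \<open>H t\<close> the final density
    \<open>G m\<close> can be replaced by \<open>G t\<close>.\<close>
  have EG: "?E (\<lambda>T. G m T * indicator (H t) T) = ?E (\<lambda>T. G t T * indicator (H t) T)" if t: "t \<le> m" for t
    unfolding G_def
  proof (rule Pi_pmf_likelihood_cong[OF A D, where I = "I t"])
    fix h :: "'b \<Rightarrow> real" assume h: "\<And>x y. x \<notin> I t \<Longrightarrow> y \<notin> I t \<Longrightarrow> h x = h y"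
    obtain c where c: "\<And>x. x \<notin> I t \<Longrightarrow> h x = c"
      using h by (cases "\<exists>y. y \<notin> I t") blast+
    have sub: "I t \<subseteq> I m" using monoD[OF I t] .
    have int': "integrable D f" for f :: "'b \<Rightarrow> real"
      using D by (rule integrable_measure_pmf_finite)
    \<comment> \<open>Subtracting \<open>c\<close> leaves a function supported in
      \<open>I t\<close>, where both weights equal \<open>\<rho>\<close>. As both weights have mean
      1, the subtracted terms agree.\<close>
    have "measure_pmf.expectation D (\<lambda>x. w m x * h x) - c * measure_pmf.expectation D (w m)
        = measure_pmf.expectation D (\<lambda>x. w m x * (h x - c))"
      by (simp add: int' right_diff_distrib mult.commute)
    also have "\<dots> = measure_pmf.expectation D (\<lambda>x. w t x * (h x - c))"
      using sub c by (intro Bochner_Integration.integral_cong) (auto simp: w_def)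
    also have "\<dots> = measure_pmf.expectation D (\<lambda>x. w t x * h x) - c * measure_pmf.expectation D (w t)"
      by (simp add: int' right_diff_distrib mult.commute)
    finally show "measure_pmf.expectation D (\<lambda>x. w m x * h x) = measure_pmf.expectation D (\<lambda>x. w t x * h x)"
      using Ew[OF t] Ew[OF order.refl] by simp
  next
    fix T T' assume *: "\<And>j. j \<in> A \<Longrightarrow> T j = T' j \<or> T j \<notin> I t \<and> T' j \<notin> I t"
    have mem: "T j \<in> I s \<longleftrightarrow> T' j \<in> I s" if "s \<le> t" "j \<in> A" for s j
      using *[OF that(2)] monoD[OF I that(1)] by auto
    have Neq: "N s T = N s T'" if "s \<le> t" for s
      unfolding N_def using mem[OF that] by (intro arg_cong[where f = card] Collect_cong) blast
    have "(\<forall>s\<in>{1..<t}. N s T \<notin> C s) \<longleftrightarrow> (\<forall>s\<in>{1..<t}. N s T' \<notin> C s)"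
      by (intro ball_cong refl) (simp add: Neq)
    thus "indicator (H t) T = (indicator (H t) T' :: real)"
      by (simp add: H_def indicator_def Neq[OF order.refl])
  qed
  have disj: "disjoint_family_on H {1..m}"
    unfolding disjoint_family_on_def
  proof (intro ballI impI)
    fix s t assume "s \<in> {1..m}" "t \<in> {1..m}" "s \<noteq> t"
    thus "H s \<inter> H t = {}" by (cases s t rule: linorder_cases) (auto simp: H_def)
  qed
  have hit: "{T. \<exists>t\<in>{1..m}. N t T \<in> C t} = (\<Union>t\<in>{1..m}. H t)"
  proof (intro equalityI subsetI)
    fix T assume "T \<in> {T. \<exists>t\<in>{1..m}. N t T \<in> C t}"
    hence ex: "\<exists>t. t \<in> {1..m} \<and> N t T \<in> C t" by blast
    define t where "t = (LEAST t. t \<in> {1..m} \<and> N t T \<in> C t)"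
    have "t \<in> {1..m} \<and> N t T \<in> C t" unfolding t_def by (rule LeastI_ex[OF ex])
    moreover have "N s T \<notin> C s" if "s \<in> {1..<t}" for s
    proof -
      have "s < (LEAST t. t \<in> {1..m} \<and> N t T \<in> C t)" using that by (simp add: t_def)
      from not_less_Least[OF this] show ?thesis using that calculation by auto
    qed
    ultimately show "T \<in> (\<Union>t\<in>{1..m}. H t)" by (auto simp: H_def)
  qed (auto simp: H_def)
  have "b * measure_pmf.prob ?P {T. \<exists>t\<in>{1..m}. N t T \<in> C t} = (\<Sum>t\<in>{1..m}. b * measure_pmf.prob ?P (H t))"
    unfolding hit by (subst measure_pmf.finite_measure_finite_Union[OF _ _ disj]) (auto simp: sum_distrib_left)
  also have "\<dots> \<le> (\<Sum>t\<in>{1..m}. ?E (\<lambda>T. G t T * indicator (H t) T))"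
  proof (rule sum_mono)
    fix t assume t: "t \<in> {1..m}"
    have "b * indicator (H t) T \<le> G t T * indicator (H t) T" for T
    proof (cases "T \<in> H t")
      case True
      have "N t T \<le> card A" using A by (auto simp: N_def intro: card_mono)
      thus ?thesis using True b[OF t, of "N t T"] by (simp add: G_eq H_def \<kappa>_def)
    qed simp
    hence "?E (\<lambda>T. b * indicator (H t) T) \<le> ?E (\<lambda>T. G t T * indicator (H t) T)"
      by (intro integral_mono int)
    thus "b * measure_pmf.prob ?P (H t) \<le> ?E (\<lambda>T. G t T * indicator (H t) T)" by simp
  qed
  also have "\<dots> = ?E (\<lambda>T. \<Sum>t\<in>{1..m}. G m T * indicator (H t) T)"
    unfolding Bochner_Integration.integral_sum[OF int] by (intro sum.cong refl EG[symmetric]) simp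
  \<comment> \<open>The events \<open>H t\<close> are disjoint, so the indicators add up to at most
    1.\<close>
  also have "\<dots> \<le> ?E (G m)"
  proof (intro integral_mono int)
    fix T
    have "(\<Sum>t\<in>{1..m}. indicator (H t) T :: real) = indicator (\<Union>t\<in>{1..m}. H t) T"
      by (rule indicator_UN_disjoint[OF _ disj, symmetric]) simp
    also have "\<dots> \<le> 1" by (simp add: indicator_def)
    finally show "(\<Sum>t\<in>{1..m}. G m T * indicator (H t) T) \<le> G m T"
      unfolding sum_distrib_left[symmetric] by (intro mult_right_le_one_le G0 sum_nonneg) auto
  qed
  also have "\<dots> = (\<Prod>j\<in>A. measure_pmf.expectation D (w m))"
    unfolding G_def
    by (rule expectation_prod_Pi_pmf[OF A integrable_measure_pmf_finite[OF D]])
       (use \<rho> \<kappa>0 in \<open>auto simp: w_def\<close>)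
  also have "\<dots> = 1" by (simp add: Ew)
  finally show ?thesis by (simp add: N_def)
qed

section \<open>Elementary inequalities for geometric weights\<close>

text \<open>Bernoulli gives \<open>1 + p * k \<le> (1 + p) ^ k\<close>, and
  \<open>(1 - p) ^ k * (1 + p) ^ k\<close> is at most 1.\<close>

lemma one_minus_power_ge:
  fixes p :: real
  assumes "0 < p" "p < 1"
  shows "p * real k / (1 + p * real k) \<le> 1 - (1 - p) ^ k"
proof -
  have "(1 - p) ^ k * (1 + p * real k) \<le> (1 - p) ^ k * (1 + p) ^ k"
    using Bernoulli_inequality[of p k] assms by (intro mult_left_mono) (auto simp: mult.commute)
  also have "\<dots> = (1 - p\<^sup>2) ^ k"
    by (simp add: power_mult_distrib[symmetric] power2_eq_square algebra_simps)
  also have "\<dots> \<le> 1" using assms by (intro power_le_one) (auto simp: power_le_one)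
  finally have "(1 - p) ^ k * (1 + p * real k) \<le> 1" .
  moreover have "0 < 1 + p * real k" using assms by (simp add: add_pos_nonneg)
  ultimately show ?thesis by (simp add: field_simps)
qed

text \<open>The increments \<open>(x - 1) * x ^ i\<close> are nondecreasing in \<open>i\<close> on
  either side of \<open>x = 1\<close>, so their average \<open>(x ^ n - 1) / n\<close> is
  nondecreasing in \<open>n\<close>. The left half of the bins uses this below 1, the right half
  above 1.\<close>

lemma mult_power_diff_one_mono:
  fixes x :: real
  assumes x: "0 \<le> x" and "t \<le> u"
  shows "real u * (x ^ t - 1) \<le> real t * (x ^ u - 1)"
  using assms(2)
proof (induction u rule: dec_induct)
  case (step u)
  have "(x - 1) * x ^ i \<le> (x - 1) * x ^ u" if "i < t" for i
  proof (cases "1 \<le> x")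
    case True
    thus ?thesis using that step by (intro mult_left_mono power_increasing) auto
  next
    case False
    thus ?thesis using that step x by (intro mult_left_mono_neg power_decreasing) auto
  qed
  hence "(\<Sum>i<t. (x - 1) * x ^ i) \<le> (\<Sum>i<t. (x - 1) * x ^ u)" by (intro sum_mono) auto
  hence "x ^ t - 1 \<le> real t * ((x - 1) * x ^ u)"
    by (simp add: power_diff_1_eq sum_distrib_left)
  thus ?case using step by (simp add: algebra_simps)
qed simp

text \<open>The bounds \<open>1 + e \<le> exp e\<close> and
  \<open>1 / \<kappa> = 1 - r \<le> exp (- r)\<close> reduce the claim to the sign of one exponent,
  which the drift hypothesis provides. A signed \<open>e\<close> serves both ends: positive on the
  left, negative on the right.\<close>

lemma likelihood_ge_one:
  fixes e F :: real
  assumes e: "-1 < e" and F: "0 \<le> F" "F < 1" "F < 1 + e" and t: "t \<le> k"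
    and drift: "0 \<le> e * (real k * F - real t * (1 + e))"
  shows "1 \<le> (1 / (1 + e)) ^ t * ((1 - 1 / (1 + e) * F) / (1 - F)) ^ (k - t)"
proof -
  define r where "r = e * F / (1 + e - F)"
  define \<kappa> where "\<kappa> = (1 - 1 / (1 + e) * F) / (1 - F)"
  have \<kappa>_eq: "\<kappa> = (1 + e - F) / ((1 + e) * (1 - F))"
    using e by (simp add: \<kappa>_def field_simps)
  have \<kappa>: "\<kappa> > 0" unfolding \<kappa>_eq using e F by simp
  have "1 / \<kappa> = 1 - r"
    using e F unfolding \<kappa>_eq r_def by (simp add: field_simps)
  also have "\<dots> \<le> exp (- r)" using exp_ge_add_one_self[of "- r"] by simp
  finally have 1: "1 / \<kappa> \<le> exp (- r)" .
  have "(1 + e) ^ t * (1 / \<kappa>) ^ (k - t) \<le> exp e ^ t * exp (- r) ^ (k - t)"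
    using e \<kappa> 1 by (intro mult_mono power_mono) auto
  also have "\<dots> = exp (real t * e - real (k - t) * r)"
    by (simp add: exp_of_nat_mult[symmetric] exp_add[symmetric])
  also have "real t * e - real (k - t) * r = - (e * (real k * F - real t * (1 + e))) / (1 + e - F)"
    using t F unfolding r_def by (simp add: of_nat_diff field_simps)
  also have "exp \<dots> \<le> 1"
    using drift F by (simp add: divide_nonpos_pos)
  finally have "(1 + e) ^ t / \<kappa> ^ (k - t) \<le> 1" by (simp add: power_one_over)
  hence "(1 + e) ^ t \<le> \<kappa> ^ (k - t)" using \<kappa> by (simp add: field_simps)
  thus ?thesis using e unfolding \<kappa>_def[symmetric] by (simp add: power_one_over field_simps)
qed

section \<open>Hitting bounds for the truncated geometric law\<close>

context
  fixes k :: nat and p q \<eta> :: real and j :: nat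
  assumes p: "0 < p" "p < 1" and k: "2 \<le> k"
  defines "q \<equiv> 1 - p" and "j \<equiv> k div 2" and "\<eta> \<equiv> (1 - (1 - p) ^ (k div 2)) / (1 + (1 - p) ^ (k div 2))"
begin

lemma one_le_bins: "1 \<le> k" using k by simp

lemma complement_bounds: "0 < q" "q < 1" using p by (auto simp: q_def)

lemma half_bounds: "1 \<le> j" "2 * j \<le> k" "j < k" "k \<le> 3 * j"
  using k by (auto simp: j_def)

lemma complement_power_bounds: "0 < q ^ i" "1 \<le> i \<Longrightarrow> q ^ i < 1"
  using complement_bounds by (auto simp: power_less_one_iff)

text \<open>For even \<open>k\<close> the first \<open>j\<close> bins have mass
  \<open>1 / (1 + q ^ j)\<close>, which is \<open>(1 + \<eta>) / 2\<close>; thus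
  \<open>\<eta>\<close> is the excess of the left half over the right.\<close>

lemma one_plus_minus_eta: "1 + \<eta> = 2 / (1 + q ^ j)" "1 - \<eta> = 2 * q ^ j / (1 + q ^ j)"
  using complement_power_bounds(1)[of j] by (simp_all add: \<eta>_def q_def[symmetric] j_def[symmetric] field_simps)

lemma eta_bounds: "0 < \<eta>" "\<eta> < 1"
  using complement_power_bounds[of j] half_bounds by (simp_all add: \<eta>_def q_def[symmetric] j_def[symmetric])

lemma cdf_bin_pmf:
  assumes "t \<le> k"
  shows "measure_pmf.prob (bin_pmf k p) {..t} = (1 - q ^ t) / (1 - q ^ k)"
proof -
  have "(\<Sum>i\<le>t. pmf (bin_pmf k p) i) = (1 - q ^ t) / (1 - q ^ k)"
    using assms
  proof (induction t)
    case (Suc t)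
    thus ?case using pmf_bin_pmf[OF p one_le_bins, of "Suc t"]
      by (simp add: q_def add_divide_distrib[symmetric] algebra_simps)
  qed (use pmf_bin_pmf[OF p one_le_bins] in simp)
  thus ?thesis by (simp add: measure_measure_pmf_finite)
qed

lemma tail_bin_pmf:
  assumes "s \<le> k"
  shows "measure_pmf.prob (bin_pmf k p) {k - s<..} = (q ^ (k - s) - q ^ k) / (1 - q ^ k)"
proof -
  have "measure_pmf.prob (bin_pmf k p) {k - s<..} = 1 - measure_pmf.prob (bin_pmf k p) {..k - s}"
    by (subst measure_pmf.prob_compl[symmetric]) (auto intro!: arg_cong[where f = "measure _"])
  thus ?thesis using cdf_bin_pmf[of "k - s"] complement_power_bounds(2)[of k] one_le_bins by (simp add: field_simps)
qed

text \<open>The ratio \<open>(1 - q ^ n) / n\<close> is nonincreasing in \<open>n\<close>. Compare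
  \<open>t\<close> with \<open>j\<close> and \<open>2 * j\<close> with \<open>k\<close>, and factor
  \<open>1 - q ^ (2 * j)\<close>; the second comparison takes care of odd \<open>k\<close>.\<close>

lemma left_drift:
  assumes "t \<le> j"
  shows "real t * (1 + \<eta>) \<le> real k * ((1 - q ^ t) / (1 - q ^ k))"
proof -
  have "real t * (1 - q ^ j) \<le> real j * (1 - q ^ t)"
    using mult_power_diff_one_mono[of q t j] complement_bounds assms by (simp add: algebra_simps)
  hence "real k * (real t * (1 - q ^ j)) * (1 + q ^ j) \<le> real k * (real j * (1 - q ^ t)) * (1 + q ^ j)"
    using complement_power_bounds(1)[of j] by (intro mult_right_mono mult_left_mono) auto
  moreover have "(real (2 * j) * (1 - q ^ k)) * real t \<le> (real k * (1 - q ^ (2 * j))) * real t"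
    using mult_power_diff_one_mono[of q "2 * j" k] complement_bounds half_bounds
    by (intro mult_right_mono) (auto simp: algebra_simps)
  moreover have "1 - q ^ (2 * j) = (1 - q ^ j) * (1 + q ^ j)"
    by (simp only: mult_2 power_add) (simp add: algebra_simps)
  ultimately have "real j * (real t * 2 * (1 - q ^ k)) \<le> real j * (real k * (1 - q ^ t) * (1 + q ^ j))"
    by (simp add: mult_ac)
  hence "real t * 2 * (1 - q ^ k) \<le> real k * (1 - q ^ t) * (1 + q ^ j)"
    by (rule mult_left_le_imp_le) (use half_bounds in simp)
  thus ?thesis unfolding one_plus_minus_eta using complement_power_bounds(1)[of j] complement_power_bounds(2)[of k] one_le_bins
    by (simp add: divide_simps mult_ac)
qed

text \<open>Mirror image of \<open>left_drift\<close>: divided by \<open>q ^ k\<close>, the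
  numerator of the tail becomes \<open>Q ^ s - 1\<close> with \<open>Q = 1 / q\<close>, and
  \<open>(Q ^ n - 1) / n\<close> is nondecreasing.\<close>

lemma right_drift:
  assumes "s \<le> j"
  shows "real k * ((q ^ (k - s) - q ^ k) / (1 - q ^ k)) \<le> real s * (1 - \<eta>)"
proof -
  define Q where "Q = 1 / q"
  have Q: "0 \<le> Q" using complement_bounds by (simp add: Q_def)
  have Qk: "q ^ k * Q ^ i = q ^ (k - i)" if "i \<le> k" for i
    using that complement_bounds by (simp add: Q_def power_one_over power_diff)
  have "real k * (real j * (Q ^ s - 1)) * (Q ^ j + 1) \<le> real k * (real s * (Q ^ j - 1)) * (Q ^ j + 1)"
    using mult_power_diff_one_mono[of Q s j] Q assms
    by (intro mult_right_mono mult_left_mono) auto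
  moreover have "(real k * (Q ^ (2 * j) - 1)) * real s \<le> (real (2 * j) * (Q ^ k - 1)) * real s"
    using mult_power_diff_one_mono[of Q "2 * j" k] Q half_bounds by (intro mult_right_mono) auto
  moreover have "Q ^ (2 * j) - 1 = (Q ^ j - 1) * (Q ^ j + 1)"
    by (simp only: mult_2 power_add) (simp add: algebra_simps)
  ultimately have "real j * (real k * (Q ^ s - 1) * (Q ^ j + 1)) \<le> real j * (real s * 2 * (Q ^ k - 1))"
    by (simp add: mult_ac)
  hence "real k * (Q ^ s - 1) * (Q ^ j + 1) \<le> real s * 2 * (Q ^ k - 1)"
    by (rule mult_left_le_imp_le) (use half_bounds in simp)
  hence "(real k * (Q ^ s - 1) * (Q ^ j + 1)) * (q ^ k * q ^ j) \<le> (real s * 2 * (Q ^ k - 1)) * (q ^ k * q ^ j)"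
    using complement_power_bounds(1) by (intro mult_right_mono) (auto simp: less_imp_le)
  hence "real k * (q ^ k * Q ^ s - q ^ k) * (q ^ j * Q ^ j + q ^ j) \<le> real s * 2 * (q ^ k * Q ^ k - q ^ k) * q ^ j"
    by (simp add: algebra_simps)
  moreover have "q ^ j * Q ^ j = 1" using complement_bounds by (simp add: Q_def power_one_over)
  ultimately have "real k * (q ^ (k - s) - q ^ k) * (1 + q ^ j) \<le> real s * 2 * (1 - q ^ k) * q ^ j"
    using Qk[of s] Qk[of k] assms half_bounds by simp
  thus ?thesis unfolding one_plus_minus_eta using complement_power_bounds(1)[of j] complement_power_bounds(2)[of k] one_le_bins
    by (simp add: divide_simps) (simp add: algebra_simps)
qed

text \<open>On the support the event says that \<open>Y\<close> reaches \<open>- L\<close> by time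
  \<open>j\<close>. The tilt lowers the mass of the early bins: the ratio with exponents
  \<open>t\<close> and \<open>k - t\<close> is at least 1 by the drift, and every ball missing from
  \<open>t\<close> gains a factor \<open>1 + \<eta>\<close>.\<close>

lemma prob_left_hitting_le:
  "(1 + \<eta>) ^ L * measure_pmf.prob (balls_pmf k p)
     {T. \<exists>t\<in>{1..j}. card {i\<in>{1..k - 1}. T i \<in> {..t}} \<in> {N. N + L < t}} \<le> 1"
  unfolding balls_pmf_def
proof (rule prob_hitting_le[where \<rho> = "1 / (1 + \<eta>)"])
  let ?F = "\<lambda>t. measure_pmf.prob (bin_pmf k p) {..t}"
  have F: "?F t < 1" if "t \<le> j" for t
  proof -
    have "q ^ k < q ^ t" using that half_bounds complement_bounds by (intro power_strict_decreasing) auto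
    thus ?thesis using that half_bounds complement_power_bounds(2)[of k] one_le_bins by (subst cdf_bin_pmf) auto
  qed
  show "?F j < 1" by (rule F) simp
  show "1 / (1 + \<eta>) * ?F j \<le> 1" using F[of j] eta_bounds by (simp add: field_simps)
  fix t N assume t: "t \<in> {1..j}" and "N \<in> {N. N + L < t}" and "N \<le> card {1..k - 1}"
  hence N: "N + L < t" by simp
  define \<kappa> where "\<kappa> = (1 - 1 / (1 + \<eta>) * ?F t) / (1 - ?F t)"
  have Ft: "?F t < 1" using F t by auto
  have tk: "t \<le> k" using t half_bounds by auto
  have "1 / (1 + \<eta>) * ?F t \<le> ?F t"
    using eta_bounds by (intro mult_left_le_one_le) auto
  hence \<kappa>: "1 \<le> \<kappa>" unfolding \<kappa>_def using Ft by (simp add: le_divide_eq)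
  have 1: "1 \<le> (1 / (1 + \<eta>)) ^ t * \<kappa> ^ (k - t)" unfolding \<kappa>_def
  proof (rule likelihood_ge_one)
    show "0 \<le> \<eta> * (real k * ?F t - real t * (1 + \<eta>))"
      using left_drift[of t] t eta_bounds by (simp add: cdf_bin_pmf[OF tk])
  qed (use eta_bounds Ft tk in \<open>auto simp: measure_nonneg\<close>)
  have "(1 + \<eta>) ^ L = (1 + \<eta>) ^ L * 1" by simp
  also have "\<dots> \<le> (1 + \<eta>) ^ (t - N) * ((1 / (1 + \<eta>)) ^ t * \<kappa> ^ (k - t))"
    using N eta_bounds 1 by (intro mult_mono power_increasing) auto
  also have "\<dots> = (1 / (1 + \<eta>)) ^ N * \<kappa> ^ (k - t)"
    using N eta_bounds by (simp add: power_one_over power_diff field_simps)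
  \<comment> \<open>From \<open>N < t\<close> follows \<open>k - t \<le> k - 1 - N\<close>; with
    \<open>1 \<le> \<kappa>\<close> this reconciles the \<open>k - 1\<close> balls with the total
    exponent \<open>k\<close> of \<open>likelihood_ge_one\<close>.\<close>
  also have "\<dots> \<le> (1 / (1 + \<eta>)) ^ N * \<kappa> ^ (k - 1 - N)"
    using N eta_bounds \<kappa> tk by (intro mult_left_mono power_increasing) auto
  finally show "(1 + \<eta>) ^ L \<le> (1 / (1 + \<eta>)) ^ N * ((1 - 1 / (1 + \<eta>) * ?F t) / (1 - ?F t)) ^ (card {1..k - 1} - N)"
    by (simp add: \<kappa>_def)
qed (use set_bin_pmf[OF p one_le_bins] eta_bounds in \<open>auto simp: mono_def\<close>)

text \<open>With \<open>t = k - s\<close>, \<open>Y\<close> being at most \<open>- L\<close> at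
  \<open>t\<close> means at least \<open>s + L\<close> balls in the last \<open>s\<close> bins. The
  tilt now raises their mass, and every surplus ball gains a factor
  \<open>1 / (1 - \<eta>)\<close>.\<close>

lemma prob_right_hitting_le:
  "(1 / (1 - \<eta>)) ^ L * measure_pmf.prob (balls_pmf k p)
     {T. \<exists>s\<in>{1..j}. card {i\<in>{1..k - 1}. T i \<in> {k - s<..}} \<in> {N. s + L \<le> N}} \<le> 1"
  unfolding balls_pmf_def
proof (rule prob_hitting_le[where \<rho> = "1 / (1 - \<eta>)"])
  let ?F = "\<lambda>s. measure_pmf.prob (bin_pmf k p) {k - s<..}"
  have F: "?F s \<le> (1 - \<eta>) / 2" "real k * ?F s \<le> real s * (1 - \<eta>)" if "s \<le> j" for s
  proof -
    show *: "real k * ?F s \<le> real s * (1 - \<eta>)"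
      using right_drift[OF that] that half_bounds by (subst tail_bin_pmf) auto
    also have "\<dots> \<le> real k / 2 * (1 - \<eta>)"
      using that half_bounds eta_bounds by (intro mult_right_mono) auto
    finally have "real k * ?F s \<le> real k * ((1 - \<eta>) / 2)" by simp
    thus "?F s \<le> (1 - \<eta>) / 2" using k by simp
  qed
  show "?F j < 1" using F(1)[of j] eta_bounds by simp
  show "1 / (1 - \<eta>) * ?F j \<le> 1" using F(1)[of j] eta_bounds by (simp add: field_simps)
  fix s N assume s: "s \<in> {1..j}" and "N \<in> {N. s + L \<le> N}" and "N \<le> card {1..k - 1}"
  hence N: "s + L \<le> N" "N \<le> k - 1" by simp_all
  define \<kappa> where "\<kappa> = (1 - 1 / (1 - \<eta>) * ?F s) / (1 - ?F s)"
  have Fs: "?F s \<le> (1 - \<eta>) / 2" "real k * ?F s \<le> real s * (1 - \<eta>)" using F s by auto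
  have sk: "s \<le> k" using s half_bounds by auto
  have \<kappa>: "0 \<le> \<kappa>" "\<kappa> \<le> 1"
  proof -
    have "1 * ?F s \<le> 1 / (1 - \<eta>) * ?F s" using eta_bounds by (intro mult_right_mono) auto
    moreover have "1 / (1 - \<eta>) * ?F s \<le> 1" using Fs eta_bounds by (simp add: divide_le_eq)
    moreover have "0 < 1 - ?F s" using Fs(1) eta_bounds by simp
    ultimately show "0 \<le> \<kappa>" "\<kappa> \<le> 1" unfolding \<kappa>_def by (auto simp: divide_le_eq)
  qed
  have 1: "1 \<le> (1 / (1 - \<eta>)) ^ s * \<kappa> ^ (k - s)" unfolding \<kappa>_def
    using likelihood_ge_one[of "- \<eta>" "?F s" s k] eta_bounds Fs sk
    by (auto simp: mult_nonneg_nonpos intro!: mult_nonneg_nonpos)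
  have "(1 / (1 - \<eta>)) ^ L = (1 / (1 - \<eta>)) ^ L * 1" by simp
  also have "\<dots> \<le> (1 / (1 - \<eta>)) ^ (N - s) * ((1 / (1 - \<eta>)) ^ s * \<kappa> ^ (k - s))"
    using N eta_bounds 1 by (intro mult_mono power_increasing) auto
  also have "\<dots> = (1 / (1 - \<eta>)) ^ N * \<kappa> ^ (k - s)"
    using N by (simp add: power_add[symmetric])
  \<comment> \<open>Here \<open>s \<le> N\<close> and \<open>\<kappa> \<le> 1\<close>, so lowering
    the exponent from \<open>k - s\<close> to \<open>k - 1 - N\<close> only increases the
    power.\<close>
  also have "\<dots> \<le> (1 / (1 - \<eta>)) ^ N * \<kappa> ^ (k - 1 - N)"
    using N eta_bounds \<kappa> sk by (intro mult_left_mono power_decreasing) auto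
  finally show "(1 / (1 - \<eta>)) ^ L \<le> (1 / (1 - \<eta>)) ^ N * ((1 - 1 / (1 - \<eta>) * ?F s) / (1 - ?F s)) ^ (card {1..k - 1} - N)"
    by (simp add: \<kappa>_def)
qed (use set_bin_pmf[OF p one_le_bins] eta_bounds in \<open>auto simp: mono_def\<close>)

text \<open>The constant 6 is 2 times 3: the denominator \<open>1 + q ^ j\<close> of
  \<open>\<eta>\<close> is at most 2, and \<open>j\<close> is at least \<open>k / 3\<close>.\<close>

lemma eta_ge: "p * real k / (6 * (1 + p * real k)) \<le> \<eta>"
proof -
  define y where "y = p * real j"
  have y: "0 < y" using p half_bounds by (simp add: y_def)
  define z where "z = p * real k"
  have z: "0 \<le> z" "z \<le> 3 * y"
    using p mult_left_mono[of "real k" "3 * real j" p] half_bounds(4) by (simp_all add: y_def z_def)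
  have "0 \<le> 2 * (3 * y - z) + 4 * (z * y)" using z y by simp
  also have "2 * (3 * y - z) + 4 * (z * y) = y * (6 * (1 + z)) - z * (2 * (1 + y))"
    by (simp add: algebra_simps)
  finally have "z * (2 * (1 + y)) \<le> y * (6 * (1 + z))" by simp
  hence "z / (6 * (1 + z)) \<le> y / (2 * (1 + y))"
    using y z by (simp add: divide_le_eq pos_le_divide_eq mult_ac)
  also have "\<dots> = y / (1 + y) / 2" by simp
  also have "\<dots> \<le> (1 - q ^ j) / 2"
    using one_minus_power_ge[OF p, of j] unfolding y_def q_def by (rule divide_right_mono) simp
  also have "\<dots> \<le> \<eta>"
    unfolding \<eta>_def q_def[symmetric] j_def[symmetric]
    using complement_power_bounds[of j] half_bounds by (intro divide_left_mono) auto
  finally show ?thesis by (simp add: z_def)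
qed

text \<open>Times up to \<open>j\<close> fall to the left bound, later ones, read as
  \<open>s = k - t\<close>, to the right bound. By Bernoulli each costs at most
  \<open>1 / (1 + \<eta> * L)\<close>; two such terms and the 6 of \<open>eta_ge\<close> give
  12.\<close>

lemma prob_Y_gt_ge:
  assumes L: "0 < L"
  shows "1 - 12 * (1 + p * real k) / (p * real k * real L)
       \<le> measure_pmf.prob (balls_pmf k p) {T. \<forall>t\<in>{1..k - 1}. Y k T t > - int L}"
proof -
  let ?P = "measure_pmf.prob (balls_pmf k p)"
  let ?A = "{T. \<exists>t\<in>{1..j}. card {i\<in>{1..k - 1}. T i \<in> {..t}} \<in> {N. N + L < t}}"
  let ?B = "{T. \<exists>s\<in>{1..j}. card {i\<in>{1..k - 1}. T i \<in> {k - s<..}} \<in> {N. s + L \<le> N}}"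
  let ?G = "{T. \<forall>t\<in>{1..k - 1}. Y k T t > - int L}"
  have sub: "T \<in> ?A \<union> ?B \<union> ?G" if T: "T \<in> set_pmf (balls_pmf k p)" for T
  proof (rule ccontr)
    assume no: "T \<notin> ?A \<union> ?B \<union> ?G"
    then obtain t where t: "t \<in> {1..k - 1}" "Y k T t \<le> - int L" by force
    have Y: "Y k T t = 1 + int (card {i\<in>{1..k - 1}. T i \<le> t}) - int t"
      by (rule Y_eq) (rule set_balls_pmf[OF p one_le_bins T])
    show False
    proof (cases "t \<le> j")
      case True
      hence "T \<in> ?A" using t Y by (intro CollectI bexI[of _ t]) auto
      thus False using no by blast
    next
      case False
      have eq: "{i\<in>{1..k - 1}. T i \<in> {k - (k - t)<..}} = {1..k - 1} - {i\<in>{1..k - 1}. T i \<le> t}"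
        using t by auto
      have "card {i\<in>{1..k - 1}. T i \<in> {k - (k - t)<..}} = k - 1 - card {i\<in>{1..k - 1}. T i \<le> t}"
        unfolding eq by (subst card_Diff_subset) auto
      moreover have "card {i\<in>{1..k - 1}. T i \<le> t} \<le> k - 1"
        by (rule order.trans[OF card_mono[of "{1..k - 1}"]]) auto
      ultimately have "k - t + L \<le> card {i\<in>{1..k - 1}. T i \<in> {k - (k - t)<..}}"
        using t Y by auto
      moreover have "k - t \<in> {1..j}" using False t by (auto simp: j_def)
      ultimately have "T \<in> ?B" by blast
      thus False using no by blast
    qed
  qed
  have pos: "0 < 1 + \<eta> * real L" using eta_bounds by (simp add: add_pos_nonneg)
  have pw: "1 + \<eta> * real L \<le> (1 + \<eta>) ^ L"
    using Bernoulli_inequality[of \<eta> L] eta_bounds by (simp add: mult.commute)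
  have pw': "1 + \<eta> * real L \<le> (1 / (1 - \<eta>)) ^ L"
  proof -
    have "1 + \<eta> \<le> 1 / (1 - \<eta>)" using eta_bounds by (simp add: field_simps)
    hence "(1 + \<eta>) ^ L \<le> (1 / (1 - \<eta>)) ^ L" using eta_bounds by (intro power_mono) auto
    thus ?thesis using pw by linarith
  qed
  have A: "?P ?A \<le> 1 / (1 + \<eta> * real L)"
    using order.trans[OF mult_right_mono[OF pw measure_nonneg] prob_left_hitting_le] pos
    by (simp add: field_simps)
  have B: "?P ?B \<le> 1 / (1 + \<eta> * real L)"
    using order.trans[OF mult_right_mono[OF pw' measure_nonneg] prob_right_hitting_le] pos
    by (simp add: field_simps)
  have "1 = ?P (?A \<union> ?B \<union> ?G)"
    using sub by (subst eq_commute, subst measure_pmf.prob_eq_1) (auto simp: AE_measure_pmf_iff)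
  also have "\<dots> \<le> ?P ?A + ?P ?B + ?P ?G"
    by (intro order.trans[OF measure_Un_le] add_right_mono measure_Un_le) auto
  finally have "1 - ?P ?G \<le> 2 / (1 + \<eta> * real L)" using A B by simp
  also have "\<dots> \<le> 2 / (\<eta> * real L)"
    using eta_bounds L by (intro divide_left_mono) (auto intro!: mult_pos_pos add_pos_pos)
  also have "\<dots> \<le> 2 / (p * real k / (6 * (1 + p * real k)) * real L)"
    using eta_ge eta_bounds L p k by (intro divide_left_mono mult_right_mono mult_pos_pos divide_pos_pos add_pos_pos) auto
  also have "\<dots> = 12 * (1 + p * real k) / (p * real k * real L)"
    by simp
  finally show ?thesis by simp
qed

end

section \<open>Moments and the central limit theorem\<close>

lemma card_nat_set_le_spread:
  fixes S :: "nat set" and r :: real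
  assumes "\<And>i. i \<in> S \<Longrightarrow> \<bar>real i - m\<bar> < r" "finite S" "0 < r"
  shows "real (card S) \<le> 2 * r + 1"
proof (cases "S = {}")
  case False
  have mem: "Min S \<in> S" "Max S \<in> S" using False assms by auto
  have "S \<subseteq> {Min S..Max S}" using assms by auto
  hence "card S \<le> card {Min S..Max S}" by (intro card_mono) auto
  moreover have "Min S \<le> Max S" using mem assms(2) by (meson Min_le)
  ultimately have "real (card S) \<le> real (Max S) - real (Min S) + 1" by (simp add: of_nat_diff)
  thus ?thesis using assms(1)[OF mem(1)] assms(1)[OF mem(2)] by linarith
qed (use assms in auto)

text \<open>A bounded mass function cannot concentrate: at most three quarters of the mass
  lie within distance \<open>1 / (4 * b)\<close> of any point.\<close>

lemma second_moment_ge_of_pmf_le: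
  fixes D :: "nat pmf" and m b :: real
  assumes D: "finite (set_pmf D)" and le: "\<And>i. pmf D i \<le> b" and b: "0 < b" "b \<le> 1 / 4"
  shows "1 / (64 * b\<^sup>2) \<le> measure_pmf.expectation D (\<lambda>i. (real i - m)\<^sup>2)"
proof -
  define r where "r = 1 / (4 * b)"
  define S where "S = {i \<in> set_pmf D. \<bar>real i - m\<bar> < r}"
  have r: "0 < r" using b by (simp add: r_def)
  have finS: "finite S" using D by (simp add: S_def)
  have "measure_pmf.prob D S = (\<Sum>i\<in>S. pmf D i)" using finS by (rule measure_measure_pmf_finite)
  also have "\<dots> \<le> (\<Sum>i\<in>S. b)" by (intro sum_mono le)
  also have "\<dots> \<le> b * (2 * r + 1)"
    using card_nat_set_le_spread[of S m r] r finS b by (simp add: S_def mult.commute mult_left_mono)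
  \<comment> \<open>With this \<open>r\<close> the bound is \<open>1 / 2 + b\<close>, and
    \<open>b \<le> 1 / 4\<close>.\<close>
  also have "\<dots> \<le> 3 / 4" using b by (simp add: r_def field_simps)
  finally have PS: "measure_pmf.prob D S \<le> 3 / 4" .
  have int: "integrable D f" for f :: "nat \<Rightarrow> real"
    using D by (rule integrable_measure_pmf_finite)
  have "1 / (64 * b\<^sup>2) = r\<^sup>2 * (1 / 4)" by (simp add: r_def power2_eq_square)
  also have "\<dots> \<le> r\<^sup>2 * (1 - measure_pmf.prob D S)" using PS by (intro mult_left_mono) auto
  also have "\<dots> = measure_pmf.expectation D (\<lambda>i. r\<^sup>2 * (1 - indicator S i))"
    by (simp add: int)
  also have "\<dots> \<le> measure_pmf.expectation D (\<lambda>i. (real i - m)\<^sup>2)"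
  proof (rule integral_mono_AE[OF int int])
    have "r\<^sup>2 * (1 - indicator S i) \<le> (real i - m)\<^sup>2" if "i \<in> set_pmf D" for i
    proof (cases "i \<in> S")
      case False
      hence "r \<le> \<bar>real i - m\<bar>" using that by (auto simp: S_def)
      hence "r\<^sup>2 \<le> \<bar>real i - m\<bar>\<^sup>2" using r by (intro power_mono) auto
      thus ?thesis using False by simp
    qed simp
    thus "AE i in D. r\<^sup>2 * (1 - indicator S i) \<le> (real i - m)\<^sup>2" by (auto simp: AE_measure_pmf_iff)
  qed
  finally show ?thesis .
qed

lemma pmf_bin_pmf_le:
  assumes p: "0 < p" "p < 1" and k: "1 \<le> k"
  shows "pmf (bin_pmf k p) i \<le> (1 + p * real k) / real k"
proof (cases "i \<in> {1..k}")
  case True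
  have pos: "0 < p * real k / (1 + p * real k)" using p k by (simp add: add_pos_pos)
  have "pmf (bin_pmf k p) i = p * (1 - p) ^ (i - 1) / (1 - (1 - p) ^ k)"
    using True by (simp add: pmf_bin_pmf[OF assms])
  also have "\<dots> \<le> p / (p * real k / (1 + p * real k))"
  proof (rule frac_le)
    show "p * (1 - p) ^ (i - 1) \<le> p" using p by (simp add: power_le_one mult_left_le)
  qed (use p pos one_minus_power_ge[OF p] in auto)
  also have "\<dots> = (1 + p * real k) / real k" using p by simp
  finally show ?thesis .
qed (use p k in \<open>simp add: pmf_bin_pmf[OF assms] del: atLeastAtMost_iff\<close>)

text \<open>The mass bound \<open>(1 + p * k) / k\<close> of \<open>pmf_bin_pmf_le\<close> enters
  \<open>second_moment_ge_of_pmf_le\<close>, whose condition that it be at most \<open>1 / 4\<close>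
  is the last hypothesis.\<close>

lemma var_bin_pmf_ge:
  assumes p: "0 < p" "p < 1" and k: "1 \<le> k" and b: "4 * (1 + p * real k) \<le> real k"
  shows "(real k / (8 * (1 + p * real k)))\<^sup>2 \<le> measure_pmf.variance (bin_pmf k p) real"
proof -
  have pos: "0 < 1 + p * real k" using p by (simp add: add_pos_nonneg)
  have "1 / (64 * ((1 + p * real k) / real k)\<^sup>2)
     \<le> measure_pmf.expectation (bin_pmf k p) (\<lambda>i. (real i - measure_pmf.expectation (bin_pmf k p) real)\<^sup>2)"
    by (rule second_moment_ge_of_pmf_le)
       (use assms pos pmf_bin_pmf_le[OF p k] set_bin_pmf[OF p k] in \<open>auto simp: field_simps\<close>)
  thus ?thesis unfolding power_divide power_mult_distrib by simp
qed

section \<open>Sums over independent balls and their normal limit\<close>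

lemma moments_sum_Pi_pmf:
  fixes g :: "'b \<Rightarrow> real"
  assumes "finite A" and D: "finite (set_pmf D)" and g: "measure_pmf.expectation D g = 0"
  shows "measure_pmf.expectation (Pi_pmf A d (\<lambda>_. D)) (\<lambda>T. \<Sum>j\<in>A. g (T j)) = 0 \<and>
     measure_pmf.expectation (Pi_pmf A d (\<lambda>_. D)) (\<lambda>T. (\<Sum>j\<in>A. g (T j))\<^sup>2)
       = real (card A) * measure_pmf.expectation D (\<lambda>x. (g x)\<^sup>2)"
  using assms(1)
proof (induction A rule: finite_induct)
  case (insert a A)
  let ?P = "Pi_pmf A d (\<lambda>_. D)"
  have int: "integrable D f" for f :: "'b \<Rightarrow> real"
    using D by (rule integrable_measure_pmf_finite)
  have "finite (set_pmf ?P)"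
    using insert(1) D by (simp add: set_Pi_pmf finite_PiE_dflt)
  hence intP: "integrable ?P f" for f :: "_ \<Rightarrow> real"
    by (rule integrable_measure_pmf_finite)
  have upd: "(\<Sum>j\<in>insert a A. g ((T(a := x)) j)) = g x + (\<Sum>j\<in>A. g (T j))" for T x
  proof -
    have "(\<Sum>j\<in>A. g ((T(a := x)) j)) = (\<Sum>j\<in>A. g (T j))"
      using insert(2) by (intro sum.cong) auto
    thus ?thesis using insert(1,2) by simp
  qed
  note E = expectation_Pi_pmf_insert[OF insert(1,2) D, of d]
  show ?case
    unfolding E upd power2_sum
    using insert g by (simp add: int intP algebra_simps)
qed simp

text \<open>Levy continuity. Each factor of the characteristic function is
  \<open>1 - t\<^sup>2 / (2 * n)\<close> up to an error of order \<open>B / (n * sqrt n)\<close>;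
  comparing \<open>n\<close>-th powers costs a factor \<open>n\<close>, so the total error is of
  order \<open>B / sqrt n\<close>.\<close>

lemma clt_triangular_array:
  fixes D :: "nat \<Rightarrow> 'b pmf" and f :: "nat \<Rightarrow> 'b \<Rightarrow> real" and n :: "nat \<Rightarrow> nat"
  assumes ev: "\<forall>\<^sub>F k in sequentially. finite (set_pmf (D k)) \<and> measure_pmf.expectation (D k) (f k) = 0 \<and>
      measure_pmf.expectation (D k) (\<lambda>x. (f k x)\<^sup>2) = 1 \<and> (\<forall>x\<in>set_pmf (D k). \<bar>f k x\<bar> \<le> B k)"
    and n: "filterlim n at_top sequentially" and B: "(\<lambda>k. B k / sqrt (real (n k))) \<longlonglongrightarrow> 0"
  shows "weak_conv_m (\<lambda>k. distr (measure_pmf (Pi_pmf {1..n k} d (\<lambda>_. D k))) borel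
            (\<lambda>T. \<Sum>j\<in>{1..n k}. f k (T j) / sqrt (real (n k)))) std_normal_distribution"
proof (rule levy_continuity)
  fix t :: real
  define \<mu> where "\<mu> k = distr (measure_pmf (D k)) borel (f k)" for k
  define P where "P k = Pi_pmf {1..n k} d (\<lambda>_. D k)" for k
  let ?\<phi> = "\<lambda>k. char (distr (measure_pmf (P k)) borel (\<lambda>T. \<Sum>j\<in>{1..n k}. f k (T j) / sqrt (real (n k)))) t"
  have char_eq: "?\<phi> k = char (\<mu> k) (t / sqrt (real (n k))) ^ n k" for k
  proof -
    have indep: "prob_space.indep_vars (measure_pmf (P k)) (\<lambda>_. borel)
        (\<lambda>j T. f k (T j) / sqrt (real (n k))) {1..n k}"
      unfolding P_def
      by (rule prob_space.indep_vars_compose2[OF measure_pmf.prob_space_axioms indep_vars_Pi_pmf]) auto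
    have "?\<phi> k = (\<Prod>j\<in>{1..n k}. char (distr (measure_pmf (P k)) borel (\<lambda>T. f k (T j) / sqrt (real (n k)))) t)"
      by (rule prob_space.char_distr_sum[OF measure_pmf.prob_space_axioms indep])
    also have "\<dots> = (\<Prod>j\<in>{1..n k}. char (\<mu> k) (t / sqrt (real (n k))))"
    proof (rule prod.cong[OF refl])
      fix j assume j: "j \<in> {1..n k}"
      have "char (distr (measure_pmf (P k)) borel (\<lambda>T. f k (T j) / sqrt (real (n k)))) t
          = measure_pmf.expectation (map_pmf (\<lambda>T. T j) (P k)) (\<lambda>x. iexp (t * (f k x / sqrt (real (n k)))))"
        by (simp add: char_def integral_distr)
      also have "map_pmf (\<lambda>T. T j) (P k) = D k"
        unfolding P_def using j by (subst Pi_pmf_component) auto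
      finally show "char (distr (measure_pmf (P k)) borel (\<lambda>T. f k (T j) / sqrt (real (n k)))) t
          = char (\<mu> k) (t / sqrt (real (n k)))"
        by (simp add: \<mu>_def char_def integral_distr)
    qed
    finally show ?thesis by simp
  qed
  \<comment> \<open>The bound \<open>t\<^sup>2 / 4\<close> keeps
    \<open>1 - t\<^sup>2 / (2 * n)\<close> in \<open>[-1, 1]\<close>, as the comparison of powers
    requires.\<close>
  have "\<forall>\<^sub>F k in sequentially. real (n k) \<ge> t\<^sup>2 / 4 \<and> n k \<ge> 1"
  proof -
    have "\<forall>\<^sub>F k in sequentially. n k \<ge> max 1 (nat \<lceil>t\<^sup>2 / 4\<rceil>)"
      using n unfolding filterlim_at_top by blast
    thus ?thesis by eventually_elim linarith
  qed
  hence main: "\<forall>\<^sub>F k in sequentially. norm (?\<phi> k - (1 + (- (t\<^sup>2) / 2) / real (n k)) ^ n k)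
      \<le> \<bar>t\<bar> ^ 3 / 6 * (B k / sqrt (real (n k)))"
    using ev
  proof eventually_elim
    case (elim k)
    let ?s = "t / sqrt (real (n k))"
    have nk: "0 < real (n k)" using elim by simp
    have fin: "finite (set_pmf (D k))" and E0: "measure_pmf.expectation (D k) (f k) = 0"
      and E2: "measure_pmf.expectation (D k) (\<lambda>x. (f k x)\<^sup>2) = 1"
      and bd: "\<And>x. x \<in> set_pmf (D k) \<Longrightarrow> \<bar>f k x\<bar> \<le> B k"
      using elim by auto
    have int: "integrable (D k) g" for g :: "'b \<Rightarrow> real"
      using fin by (rule integrable_measure_pmf_finite)
    interpret \<mu>: real_distribution "\<mu> k"
      unfolding \<mu>_def by (rule prob_space.real_distribution_distr[OF measure_pmf.prob_space_axioms]) simp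
    have "norm (char (\<mu> k) ?s - (1 - ?s\<^sup>2 * 1 / 2))
        \<le> ?s\<^sup>2 / 6 * measure_pmf.expectation (D k) (\<lambda>x. min (6 * (f k x)\<^sup>2) (\<bar>?s\<bar> * \<bar>f k x\<bar> ^ 3))"
      by (rule prob_space.char_approx3'[OF measure_pmf.prob_space_axioms]) (auto simp: int E0 E2 \<mu>_def)
    \<comment> \<open>The third absolute moment is at most \<open>B k\<close> times the second,
      which is 1.\<close>
    also have "\<dots> \<le> ?s\<^sup>2 / 6 * measure_pmf.expectation (D k) (\<lambda>x. \<bar>?s\<bar> * B k * (f k x)\<^sup>2)"
    proof (intro mult_left_mono integral_mono_AE int)
      have "min (6 * (f k x)\<^sup>2) (\<bar>?s\<bar> * \<bar>f k x\<bar> ^ 3) \<le> \<bar>?s\<bar> * B k * (f k x)\<^sup>2" if "x \<in> set_pmf (D k)" for x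
      proof -
        have "\<bar>?s\<bar> * \<bar>f k x\<bar> ^ 3 = \<bar>?s\<bar> * (\<bar>f k x\<bar> * (f k x)\<^sup>2)"
          by (simp add: power3_eq_cube power2_eq_square abs_mult_self_eq mult.assoc)
        also have "\<dots> \<le> \<bar>?s\<bar> * (B k * (f k x)\<^sup>2)"
          using bd[OF that] by (intro mult_left_mono mult_right_mono) auto
        finally show ?thesis by (simp add: min.coboundedI2 mult.assoc)
      qed
      thus "AE x in D k. min (6 * (f k x)\<^sup>2) (\<bar>?s\<bar> * \<bar>f k x\<bar> ^ 3) \<le> \<bar>?s\<bar> * B k * (f k x)\<^sup>2"
        by (auto simp: AE_measure_pmf_iff)
    qed auto
    also have "\<dots> = ?s\<^sup>2 / 6 * (\<bar>?s\<bar> * B k)" by (simp add: E2)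
    also have "\<dots> = (\<bar>t\<bar> ^ 3 / 6 * (B k / sqrt (real (n k)))) / real (n k)"
      using nk by (simp add: power_divide power3_eq_cube power2_eq_square abs_mult_self_eq mult_ac)
    finally have 1: "norm (char (\<mu> k) ?s - (1 - ?s\<^sup>2 * 1 / 2)) \<le> (\<bar>t\<bar> ^ 3 / 6 * (B k / sqrt (real (n k)))) / real (n k)" .
    have 2: "complex_of_real (1 + (- (t\<^sup>2) / 2) / real (n k)) = (1 - ?s\<^sup>2 * 1 / 2)"
      using nk by (simp add: power_divide field_simps)
    have "norm (?\<phi> k - (complex_of_real (1 + (- (t\<^sup>2) / 2) / real (n k))) ^ n k)
       \<le> real (n k) * norm (char (\<mu> k) ?s - complex_of_real (1 + (- (t\<^sup>2) / 2) / real (n k)))"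
      unfolding char_eq
    proof (rule norm_power_diff)
      show "norm (char (\<mu> k) ?s) \<le> 1" by (rule \<mu>.cmod_char_le_1)
      have "\<bar>1 + (- (t\<^sup>2) / 2) / real (n k)\<bar> \<le> 1"
        using elim nk by (intro abs_leI) (auto simp: field_simps)
      thus "norm (complex_of_real (1 + (- (t\<^sup>2) / 2) / real (n k))) \<le> 1" by (simp only: norm_of_real)
    qed
    also have "\<dots> \<le> real (n k) * ((\<bar>t\<bar> ^ 3 / 6 * (B k / sqrt (real (n k)))) / real (n k))"
      unfolding 2 by (intro mult_left_mono) (use 1 in auto)
    also have "\<dots> = \<bar>t\<bar> ^ 3 / 6 * (B k / sqrt (real (n k)))" using nk by simp
    finally show ?case by simp
  qed
  have "(\<lambda>k. (1 + (- (t\<^sup>2) / 2) / real (n k)) ^ n k) \<longlonglongrightarrow> exp (- (t\<^sup>2) / 2)"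
    using filterlim_compose[OF tendsto_exp_limit_sequentially n] .
  hence lim: "(\<lambda>k. complex_of_real ((1 + (- (t\<^sup>2) / 2) / real (n k)) ^ n k)) \<longlonglongrightarrow> complex_of_real (exp (- (t\<^sup>2) / 2))"
    by (rule tendsto_of_real)
  have "(\<lambda>k. \<bar>t\<bar> ^ 3 / 6 * (B k / sqrt (real (n k)))) \<longlonglongrightarrow> 0"
    using tendsto_mult_right_zero[OF B] .
  from tendsto_add[OF Lim_null_comparison[OF main this] lim]
  have "?\<phi> \<longlonglongrightarrow> complex_of_real (exp (- (t\<^sup>2) / 2))" by simp
  thus "(\<lambda>k. char (distr (measure_pmf (Pi_pmf {1..n k} d (\<lambda>_. D k))) borel
      (\<lambda>T. \<Sum>j\<in>{1..n k}. f k (T j) / sqrt (real (n k)))) t) \<longlonglongrightarrow> char std_normal_distribution t"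
    by (simp add: char_std_normal_distribution P_def)
qed (auto intro!: real_dist_normal_dist prob_space.real_distribution_distr[OF measure_pmf.prob_space_axioms])

lemma cdf_std_normal_distribution:
  "cdf std_normal_distribution u = (LBINT t:{..u}. 1 / sqrt (2 * pi) * exp (- t\<^sup>2 / 2))"
proof -
  have "cdf std_normal_distribution u = (\<integral>x. indicator {..u} x \<partial>std_normal_distribution)"
    by (simp add: cdf_def)
  also have "\<dots> = (\<integral>x. std_normal_density x *\<^sub>R indicator {..u} x \<partial>lborel)"
    by (subst integral_density) auto
  also have "\<dots> = (LBINT t:{..u}. 1 / sqrt (2 * pi) * exp (- t\<^sup>2 / 2))"
    by (simp add: set_lebesgue_integral_def std_normal_density_def mult_ac)
  finally show ?thesis .
qed

text \<open>The law has a density, hence no atoms. Continuity is used twice: weak convergence gives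
  convergence of distribution functions at continuity points, and the final squeeze moves the
  argument by a small amount.\<close>

lemma isCont_cdf_std_normal: "isCont (cdf std_normal_distribution) u"
proof -
  interpret real_distribution std_normal_distribution by (rule real_dist_normal_dist)
  have "emeasure std_normal_distribution {u} = 0"
    by (subst emeasure_density) (auto simp: nn_integral_indicator_singleton' )
  thus ?thesis by (simp add: isCont_cdf measure_def)
qed

section \<open>The conditional limit law\<close>

lemma prob_greaterThan_eq: "measure_pmf.prob D {x. f x > y} = 1 - measure_pmf.prob D {x. f x \<le> y}"
  for f :: "'a \<Rightarrow> real"
  by (subst measure_pmf.prob_compl[symmetric]) (auto intro!: arg_cong[where f = "measure _"])

text \<open>Conditioning on \<open>TREE\<close> raises \<open>M\<close>, which gives the upper
  bound. It does so by no more than \<open>L * (k - 1)\<close>, up to the probability that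
  \<open>Y\<close> reaches \<open>- L\<close>, which gives the lower bound.\<close>

lemma
  assumes p: "0 < p" "p < 1" and k: "2 \<le> k"
  shows M_star_cdf_le: "measure_pmf.prob (M_star_pmf k p) {x. x \<le> y}
      \<le> measure_pmf.prob (balls_pmf k p) {T. M k T \<le> y}"
    and M_star_cdf_ge: "0 < L \<Longrightarrow> measure_pmf.prob (balls_pmf k p) {T. M k T \<le> y - real L * real (k - 1)}
        - 12 * (1 + p * real k) / (p * real k * real L)
      \<le> measure_pmf.prob (M_star_pmf k p) {x. x \<le> y}"
proof -
  have k1: "1 \<le> k" using k by simp
  let ?P = "measure_pmf.prob (balls_pmf k p)" and ?S = "measure_pmf.prob (M_star_pmf k p)"
  have pos: "0 < ?P (TREE k)"
    using balls_pmf_TREE_nonempty[OF p k1] by (auto intro: measure_pmf_posI)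
  have "?P {T. M k T > y} * ?P (TREE k) \<le> ?S {x. x > y} * ?P (TREE k)"
    using prob_M_mult_TREE_le[OF p k1, of y] prob_M_star[OF p k1, of y] by simp
  hence "?P {T. M k T > y} \<le> ?S {x. x > y}" using pos by simp
  thus "?S {x. x \<le> y} \<le> ?P {T. M k T \<le> y}"
    by (simp add: prob_greaterThan_eq)
  assume L: "0 < L"
  let ?B = "?P {T. \<forall>t\<in>{1..k - 1}. Y k T t > - int L}"
  have "?S {x. x > y} * ?B * ?P (TREE k) = ?P (TREE k \<inter> {T. M k T > y}) * ?B"
    unfolding prob_M_star[OF p k1, symmetric] by (simp only: mult_ac)
  also have "\<dots> \<le> ?P {T. M k T > y - real L * real (k - 1)} * ?P (TREE k)"
    using prob_TREE_M_shift_le[OF p k1, of y L] by (simp only: mult.commute)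
  finally have "?S {x. x > y} * ?B * ?P (TREE k) \<le> ?P {T. M k T > y - real L * real (k - 1)} * ?P (TREE k)" .
  hence "?S {x. x > y} * ?B \<le> ?P {T. M k T > y - real L * real (k - 1)}" using pos by simp
  \<comment> \<open>Trading the factor \<open>?B\<close> for the additive loss \<open>1 - ?B\<close>
    avoids dividing by a probability.\<close>
  moreover have "?S {x. x > y} * (1 - ?B) \<le> 1 - ?B"
    by (rule mult_left_le_one_le) auto
  hence "?S {x. x > y} - ?S {x. x > y} * ?B \<le> 1 - ?B" by (simp add: right_diff_distrib)
  moreover have "1 - ?B \<le> 12 * (1 + p * real k) / (p * real k * real L)"
    using prob_Y_gt_ge[OF p k L] by simp
  ultimately have "?S {x. x > y} \<le> ?P {T. M k T > y - real L * real (k - 1)} + 12 * (1 + p * real k) / (p * real k * real L)"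
    by linarith
  thus "?P {T. M k T \<le> y - real L * real (k - 1)} - 12 * (1 + p * real k) / (p * real k * real L) \<le> ?S {x. x \<le> y}"
    unfolding prob_greaterThan_eq by linarith
qed

lemma
  assumes p: "0 < p" "p < 1" and k: "1 \<le> k"
  defines "m \<equiv> measure_pmf.expectation (bin_pmf k p) real"
  shows M_minus_mean: "M k T - mean_M k p = (\<Sum>j=1..k - 1. - (real (T j) - m))"
    and var_M_eq: "var_M k p = real (k - 1) * measure_pmf.variance (bin_pmf k p) real"
proof -
  have fin: "finite (set_pmf (bin_pmf k p))" using set_bin_pmf[OF p k] by simp
  have finP: "finite (set_pmf (balls_pmf k p))"
    using fin by (simp add: balls_pmf_def set_Pi_pmf finite_PiE_dflt)
  have int: "integrable (bin_pmf k p) f" for f :: "nat \<Rightarrow> real"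
    using fin by (rule integrable_measure_pmf_finite)
  have intP: "integrable (balls_pmf k p) f" for f :: "_ \<Rightarrow> real"
    using finP by (rule integrable_measure_pmf_finite)
  have "measure_pmf.expectation (bin_pmf k p) (\<lambda>i. - (real i - m)) = 0"
    by (simp add: int m_def)
  from moments_sum_Pi_pmf[OF _ fin this, of "{1..k - 1}" 0]
  have mom: "measure_pmf.expectation (balls_pmf k p) (\<lambda>T. \<Sum>j=1..k - 1. - (real (T j) - m)) = 0"
    "measure_pmf.expectation (balls_pmf k p) (\<lambda>T. (\<Sum>j=1..k - 1. - (real (T j) - m))\<^sup>2)
      = real (k - 1) * measure_pmf.expectation (bin_pmf k p) (\<lambda>i. (- (real i - m))\<^sup>2)"
    by (simp_all add: balls_pmf_def)
  have M: "M k T = (\<Sum>j=1..k - 1. - (real (T j) - m)) + (real (k choose 2) - real (k - 1) * m)" for T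
    by (simp add: M_def sum_subtractf)
  have "mean_M k p = real (k choose 2) - real (k - 1) * m"
    unfolding mean_M_def M using mom(1) by (subst Bochner_Integration.integral_add[OF intP intP]) simp
  thus eq: "M k T - mean_M k p = (\<Sum>j=1..k - 1. - (real (T j) - m))" for T
    by (simp only: M)
  show "var_M k p = real (k - 1) * measure_pmf.variance (bin_pmf k p) real"
    using mom(2) unfolding var_M_def mean_M_def[symmetric] eq power2_minus m_def .
qed

text \<open>A ball deviates from its mean by at most \<open>k\<close>, and its standard deviation is
  at least \<open>k / (8 * (1 + p k * k))\<close>. Standardised summands are thus bounded by
  \<open>8 * (1 + p k * k)\<close>, and the second hypothesis is the smallness condition of
  \<open>clt_triangular_array\<close>.\<close>

lemma clt_M:
  fixes p :: "nat \<Rightarrow> real"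
  assumes ev: "\<forall>\<^sub>F k in sequentially. 0 < p k \<and> p k < 1 \<and> 4 * (1 + p k * real k) \<le> real k"
    and B: "(\<lambda>k. (1 + p k * real k) / sqrt (real k)) \<longlonglongrightarrow> 0"
  shows "(\<lambda>k. measure_pmf.prob (balls_pmf k (p k)) {T. M k T \<le> mean_M k (p k) + u * sqrt (var_M k (p k))})
           \<longlonglongrightarrow> cdf std_normal_distribution u"
proof -
  define D where "D k = bin_pmf k (p k)" for k
  define m where "m k = measure_pmf.expectation (D k) real" for k
  define s where "s k = sqrt (measure_pmf.variance (D k) real)" for k
  \<comment> \<open>The sign is reversed because \<open>M\<close> decreases in each
    \<open>T j\<close>.\<close>
  define f where "f k i = - (real i - m k) / s k" for k i
  have ev2: "\<forall>\<^sub>F k in sequentially. 2 \<le> k" by (rule eventually_ge_at_top)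
  have s_ge: "real k / (8 * (1 + p k * real k)) \<le> s k"
    if "0 < p k" "p k < 1" "4 * (1 + p k * real k) \<le> real k" "2 \<le> k" for k
    unfolding s_def D_def using var_bin_pmf_ge[of "p k" k] that by (intro real_le_rsqrt) auto
  have s_pos: "0 < s k" if "0 < p k" "p k < 1" "4 * (1 + p k * real k) \<le> real k" "2 \<le> k" for k
  proof -
    have "0 < real k / (8 * (1 + p k * real k))" using that by (simp add: add_pos_nonneg)
    thus ?thesis using s_ge[OF that] by linarith
  qed
  have "weak_conv_m (\<lambda>k. distr (measure_pmf (Pi_pmf {1..k - 1} 0 (\<lambda>_. D k))) borel
          (\<lambda>T. \<Sum>j\<in>{1..k - 1}. f k (T j) / sqrt (real (k - 1)))) std_normal_distribution"
  proof (rule clt_triangular_array)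
    show "\<forall>\<^sub>F k in sequentially. finite (set_pmf (D k)) \<and> measure_pmf.expectation (D k) (f k) = 0 \<and>
      measure_pmf.expectation (D k) (\<lambda>x. (f k x)\<^sup>2) = 1 \<and> (\<forall>x\<in>set_pmf (D k). \<bar>f k x\<bar> \<le> 8 * (1 + p k * real k))"
      using ev ev2
    proof eventually_elim
      case (elim k)
      have sp: "0 < s k" and sg: "real k / (8 * (1 + p k * real k)) \<le> s k" using s_pos s_ge elim by auto
      have set: "set_pmf (D k) = {1..k}" unfolding D_def using elim by (intro set_bin_pmf) auto
      hence fin: "finite (set_pmf (D k))" by simp
      hence int: "integrable (D k) g" for g :: "nat \<Rightarrow> real"
        by (rule integrable_measure_pmf_finite)
      have "measure_pmf.expectation (D k) (f k) = 0"
        unfolding f_def by (simp add: int m_def)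
      moreover have "measure_pmf.expectation (D k) (\<lambda>x. (f k x)\<^sup>2) = measure_pmf.variance (D k) real / (s k)\<^sup>2"
        unfolding f_def m_def by (simp add: int power_divide power2_commute)
      moreover have "\<bar>f k x\<bar> \<le> 8 * (1 + p k * real k)" if "x \<in> set_pmf (D k)" for x
      proof -
        have "0 \<le> m k" unfolding m_def by (intro integral_nonneg_AE) auto
        moreover have "m k \<le> measure_pmf.expectation (D k) (\<lambda>_. real k)" unfolding m_def
          by (intro integral_mono_AE int) (auto simp: AE_measure_pmf_iff set)
        ultimately have "\<bar>real x - m k\<bar> \<le> real k" using that by (auto simp: set)
        hence "\<bar>f k x\<bar> \<le> real k / s k" using sp by (simp add: f_def abs_divide divide_right_mono abs_minus_commute)
        also have "\<dots> \<le> 8 * (1 + p k * real k)"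
          using sg sp elim by (simp add: divide_le_eq pos_divide_le_eq add_pos_nonneg mult_ac)
        finally show ?thesis .
      qed
      moreover have "(s k)\<^sup>2 = measure_pmf.variance (D k) real"
        unfolding s_def by (intro real_sqrt_pow2 integral_nonneg_AE) auto
      ultimately show ?case using fin sp by auto
    qed
    show "filterlim (\<lambda>k. k - 1) at_top sequentially" by (rule filterlim_minus_const_nat_at_top)
    show "(\<lambda>k. 8 * (1 + p k * real k) / sqrt (real (k - 1))) \<longlonglongrightarrow> 0"
    proof -
      have "(\<lambda>k. sqrt (real k) / sqrt (real (k - 1))) \<longlonglongrightarrow> 1" by real_asymp
      from tendsto_mult[OF tendsto_mult[OF tendsto_const[of 8] B] this]
      have "(\<lambda>k. 8 * ((1 + p k * real k) / sqrt (real k)) * (sqrt (real k) / sqrt (real (k - 1)))) \<longlonglongrightarrow> 0" by simp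
      thus ?thesis by (rule Lim_transform_eventually) (use ev2 in eventually_elim, simp)
    qed
  qed
  hence lim: "(\<lambda>k. cdf (distr (measure_pmf (Pi_pmf {1..k - 1} 0 (\<lambda>_. D k))) borel
          (\<lambda>T. \<Sum>j\<in>{1..k - 1}. f k (T j) / sqrt (real (k - 1)))) u) \<longlonglongrightarrow> cdf std_normal_distribution u"
    using isCont_cdf_std_normal by (simp add: weak_conv_m_def weak_conv_def)
  show ?thesis
  proof (rule Lim_transform_eventually[OF lim], use ev ev2 in eventually_elim)
    case (elim k)
    have sp: "0 < s k" using s_pos elim by auto
    have k1: "1 \<le> k" using elim by simp
    have var: "sqrt (var_M k (p k)) = sqrt (real (k - 1)) * s k"
      using elim by (subst var_M_eq) (auto simp: real_sqrt_mult s_def D_def)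
    have "(\<Sum>j\<in>{1..k - 1}. f k (T j) / sqrt (real (k - 1))) \<le> u \<longleftrightarrow>
        M k T \<le> mean_M k (p k) + u * sqrt (var_M k (p k))" for T
    proof -
      have "(\<Sum>j\<in>{1..k - 1}. f k (T j) / sqrt (real (k - 1)))
         = (\<Sum>j=1..k - 1. - (real (T j) - m k)) / sqrt (var_M k (p k))"
        unfolding var f_def sum_divide_distrib by (simp add: mult_ac)
      also have "(\<Sum>j=1..k - 1. - (real (T j) - m k)) = M k T - mean_M k (p k)"
        using elim unfolding m_def D_def by (subst M_minus_mean) auto
      finally show ?thesis using sp elim by (simp add: var divide_le_eq algebra_simps)
    qed
    thus ?case by (simp add: cdf_def measure_distr D_def balls_pmf_def vimage_def)
  qed
qed

theorem theorem5:
  fixes p :: "nat \<Rightarrow> real" and u :: real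
  assumes "filterlim (\<lambda>k. p k / real k powr (- 3 / 2)) at_top sequentially"
    and "\<forall>\<^sub>F k in sequentially. p k \<le> 10 * ln (real k) / real k"
  shows "(\<lambda>k. measure_pmf.prob (M_star_pmf k (p k))
             {x. x \<le> mean_M k (p k) + u * sqrt (var_M k (p k))})
           \<longlonglongrightarrow> (LBINT t:{..u}. 1 / sqrt (2 * pi) * exp (- t\<^sup>2 / 2))"
proof -
  define c where "c k = p k * real k" for k
  \<comment> \<open>This is \<open>p k\<close> times \<open>k powr (3 / 2)\<close>, so the first
    hypothesis says that \<open>h\<close> tends to infinity. Eventual positivity of
    \<open>p k\<close> follows from it as well.\<close>
  define h where "h k = sqrt (real k) * c k" for k
  have ev2: "\<forall>\<^sub>F k in sequentially. 2 \<le> k" by (rule eventually_ge_at_top)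
  have "\<forall>\<^sub>F k in sequentially. p k / real k powr (- 3 / 2) = h k"
    using ev2
  proof eventually_elim
    case (elim k)
    have "real k powr (3 / 2) = real k powr (1 + 1 / 2)" by simp
    also have "\<dots> = real k * sqrt (real k)"
      using elim by (subst powr_add) (simp add: powr_half_sqrt)
    finally have "real k powr (- 3 / 2) = 1 / (real k * sqrt (real k))"
      using powr_minus_divide[of "real k" "3 / 2"] by simp
    thus ?case by (simp add: h_def c_def)
  qed
  hence h: "filterlim h at_top sequentially"
    using assms(1) by (subst (asm) filterlim_cong[OF refl refl]) auto
  have ev_c: "\<forall>\<^sub>F k in sequentially. 0 < c k \<and> c k \<le> 10 * ln (real k)"
    using ev2 assms(2) filterlim_at_top_dense[THEN iffD1, rule_format, OF h, of 0]
  proof eventually_elim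
    case (elim k)
    have "c k \<le> 10 * ln (real k) / real k * real k"
      unfolding c_def by (intro mult_right_mono elim) auto
    thus ?case using elim by (simp add: h_def zero_less_mult_iff)
  qed
  have c_sqrt: "(\<lambda>k. c k / sqrt (real k)) \<longlonglongrightarrow> 0"
  proof (rule tendsto_sandwich[of "\<lambda>_. 0" _ _ "\<lambda>k. 10 * ln (real k) / sqrt (real k)"])
    show "(\<lambda>k. 10 * ln (real k) / sqrt (real k)) \<longlonglongrightarrow> 0" by real_asymp
  qed (use ev_c in \<open>auto elim!: eventually_mono intro!: divide_right_mono\<close>)
  have inv_sqrt: "(\<lambda>k. 1 / sqrt (real k)) \<longlonglongrightarrow> 0" by real_asymp
  have B: "(\<lambda>k. (1 + c k) / sqrt (real k)) \<longlonglongrightarrow> 0"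
    using tendsto_add[OF inv_sqrt c_sqrt] by (simp add: add_divide_distrib)
  have ev: "\<forall>\<^sub>F k in sequentially. 0 < p k \<and> p k < 1 \<and> 4 * (1 + p k * real k) \<le> real k"
  proof -
    have "\<forall>\<^sub>F k in sequentially. 4 * (1 + 10 * ln (real k)) \<le> real k" by real_asymp
    thus ?thesis using ev_c ev2
    proof eventually_elim
      case (elim k)
      have c: "0 < c k" "c k \<le> 10 * ln (real k)" using elim by auto
      hence "4 * (1 + c k) \<le> 4 * (1 + 10 * ln (real k))" by simp
      hence "4 * (1 + c k) \<le> real k" using elim(1) by (rule order.trans)
      have "c k < 4 * (1 + c k)" using c by simp
      also note \<open>4 * (1 + c k) \<le> real k\<close>
      finally have "p k * real k < 1 * real k" by (simp add: c_def)
      hence "p k < 1" by (rule mult_right_less_imp_less) simp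
      thus ?case using c(1) \<open>4 * (1 + c k) \<le> real k\<close> by (auto simp: c_def zero_less_mult_iff)
    qed
  qed
  \<comment> \<open>The errors below are controlled by
    \<open>sqrt (r k) = (1 + c k) / sqrt (h k)\<close>. Expanding the square gives
    \<open>1 / h + 2 / sqrt k + c / sqrt k\<close>: the lower bound on \<open>p\<close> controls the
    first term, the upper bound the last.\<close>
  define r where "r k = (1 + c k)\<^sup>2 / h k" for k
  have "(\<lambda>k. 1 / h k + 2 * (1 / sqrt (real k)) + c k / sqrt (real k)) \<longlonglongrightarrow> 0 + 2 * 0 + 0"
    by (intro tendsto_intros inv_sqrt c_sqrt tendsto_divide_0[OF tendsto_const]
          filterlim_at_top_imp_at_infinity h)
  hence "r \<longlonglongrightarrow> 0 + 2 * 0 + 0"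
  proof (rule Lim_transform_eventually)
    show "\<forall>\<^sub>F k in sequentially. 1 / h k + 2 * (1 / sqrt (real k)) + c k / sqrt (real k) = r k"
      using ev_c ev2
    proof eventually_elim
      case (elim k)
      hence "0 < sqrt (real k)" "0 < c k" by auto
      thus ?case by (simp add: r_def h_def field_simps power2_eq_square)
    qed
  qed
  from tendsto_real_sqrt[OF this] have r: "(\<lambda>k. sqrt (r k)) \<longlonglongrightarrow> 0" by simp
  \<comment> \<open>The choice balances the hitting bound, of order
    \<open>(1 + c) / (c * L)\<close>, against the relative shift, of order
    \<open>L * (1 + c) / sqrt k\<close>: at \<open>L = w\<close> both are of order
    \<open>(1 + c) / sqrt h\<close>. Rounding up makes \<open>L\<close> a positive integer and adds
    order \<open>(1 + c) / sqrt k\<close> to the shift.\<close>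
  define w where "w k = sqrt (sqrt (real k) / c k)" for k
  define L where "L k = nat \<lceil>w k\<rceil>" for k
  have w: "0 < w k" "w k \<le> real (L k)" "real (L k) \<le> w k + 1" "0 < L k"
      "c k * w k = sqrt (h k)" "w k / sqrt (real k) = 1 / sqrt (h k)"
    if "0 < c k" "2 \<le> k" for k
  proof -
    show "0 < w k" using that by (simp add: w_def)
    thus "w k \<le> real (L k)" "real (L k) \<le> w k + 1" "0 < L k" unfolding L_def by linarith+
    have "c k * w k = sqrt ((c k)\<^sup>2) * sqrt (sqrt (real k) / c k)" using that by (simp add: w_def)
    also have "\<dots> = sqrt (h k)"
      unfolding real_sqrt_mult[symmetric] using that by (simp add: h_def power2_eq_square)
    finally show "c k * w k = sqrt (h k)" .
    have "w k * sqrt (h k) = sqrt (sqrt (real k) / c k * (sqrt (real k) * c k))"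
      by (simp only: w_def h_def real_sqrt_mult)
    also have "sqrt (real k) / c k * (sqrt (real k) * c k) = real k" using that by simp
    finally show "w k / sqrt (real k) = 1 / sqrt (h k)"
      using that by (simp add: h_def field_simps)
  qed
  have sqrt_r: "sqrt (r k) = (1 + c k) / sqrt (h k)" if "0 < c k" for k
    using that by (simp add: r_def real_sqrt_divide)
  let ?G = "\<lambda>u k. measure_pmf.prob (balls_pmf k (p k)) {T. M k T \<le> mean_M k (p k) + u * sqrt (var_M k (p k))}"
  let ?S = "\<lambda>k. measure_pmf.prob (M_star_pmf k (p k)) {x. x \<le> mean_M k (p k) + u * sqrt (var_M k (p k))}"
  have G: "?G v \<longlonglongrightarrow> cdf std_normal_distribution v" for v
    by (rule clt_M[OF ev]) (use B in \<open>simp add: c_def\<close>)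
  have upper: "\<forall>\<^sub>F k in sequentially. ?S k \<le> ?G u k"
    using ev ev2 by eventually_elim (intro M_star_cdf_le, auto)
  \<comment> \<open>Here \<open>\<epsilon>\<close> bounds the shift \<open>L * (k - 1)\<close> in
    units of the standard deviation, and stays fixed as \<open>k\<close> grows.\<close>
  have lower: "\<forall>\<^sub>F k in sequentially. ?G (u - \<epsilon>) k - 12 * sqrt (r k) \<le> ?S k" if \<epsilon>: "0 < \<epsilon>" for \<epsilon>
  proof -
    have "(\<lambda>k. 8 * (sqrt (r k) + (1 + c k) / sqrt (real k))) \<longlonglongrightarrow> 8 * (0 + 0)"
      by (intro tendsto_intros r B)
    hence "\<forall>\<^sub>F k in sequentially. 8 * (sqrt (r k) + (1 + c k) / sqrt (real k)) < \<epsilon>"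
      using \<epsilon> by (intro order_tendstoD) auto
    thus ?thesis using ev ev2 ev_c
    proof eventually_elim
      case (elim k)
      have c: "0 < c k" and k: "2 \<le> k" and p: "0 < p k" "p k < 1" using elim by auto
      note w = w[OF c k]
      have "real (L k) * (8 * (1 + c k)) / sqrt (real k) \<le> (w k + 1) * (8 * (1 + c k)) / sqrt (real k)"
        using w c by (intro divide_right_mono mult_right_mono) auto
      also have "\<dots> = 8 * ((w k / sqrt (real k)) * (1 + c k) + (1 + c k) / sqrt (real k))"
        using k by (simp add: divide_simps) (simp add: algebra_simps)
      also have "\<dots> = 8 * (sqrt (r k) + (1 + c k) / sqrt (real k))"
        by (simp only: w sqrt_r[OF c]) simp
      finally have 1: "real (L k) * (8 * (1 + c k)) / sqrt (real k) \<le> \<epsilon>" using elim(1) by simp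
      have sd: "sqrt (real (k - 1)) * (real k / (8 * (1 + c k))) \<le> sqrt (var_M k (p k))"
      proof -
        have "(real k / (8 * (1 + c k)))\<^sup>2 \<le> measure_pmf.variance (bin_pmf k (p k)) real"
          unfolding c_def using elim by (intro var_bin_pmf_ge) auto
        hence sd: "real k / (8 * (1 + c k)) \<le> sqrt (measure_pmf.variance (bin_pmf k (p k)) real)"
          by (rule real_le_rsqrt)
        have var: "var_M k (p k) = real (k - 1) * measure_pmf.variance (bin_pmf k (p k)) real"
          using p k by (intro var_M_eq) auto
        show ?thesis unfolding var real_sqrt_mult by (intro mult_left_mono sd) simp
      qed
      \<comment> \<open>Writing \<open>k - 1\<close> as a product of two square roots makes the
        lower bound \<open>sd\<close> for the standard deviation appear as a factor.\<close>
      have "real (L k) * real (k - 1)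
          = (real (L k) * (8 * (1 + c k)) / real k * sqrt (real (k - 1))) * (sqrt (real (k - 1)) * (real k / (8 * (1 + c k))))"
      proof -
        have "real (k - 1) = sqrt (real (k - 1)) * sqrt (real (k - 1))" by simp
        thus ?thesis using c k by (simp add: divide_simps)
      qed
      also have "\<dots> \<le> \<epsilon> * sqrt (var_M k (p k))"
      proof (rule mult_mono[OF _ sd])
        have "real (L k) * (8 * (1 + c k)) / real k * sqrt (real (k - 1))
           \<le> real (L k) * (8 * (1 + c k)) / real k * sqrt (real k)"
          using c by (intro mult_left_mono) auto
        also have "\<dots> = real (L k) * (8 * (1 + c k)) / sqrt (real k)"
        proof -
          have "sqrt (real k) / real k = inverse (sqrt (real k))" by (simp add: sqrt_divide_self_eq)
          hence "real (L k) * (8 * (1 + c k)) * (sqrt (real k) / real k)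
              = real (L k) * (8 * (1 + c k)) * inverse (sqrt (real k))" by (rule arg_cong)
          thus ?thesis by (simp add: divide_inverse mult_ac)
        qed
        finally show "real (L k) * (8 * (1 + c k)) / real k * sqrt (real (k - 1)) \<le> \<epsilon>" using 1 by (rule order.trans)
      qed (use \<epsilon> c in auto)
      finally have shift: "(u - \<epsilon>) * sqrt (var_M k (p k)) \<le> u * sqrt (var_M k (p k)) - real (L k) * real (k - 1)"
        by (simp add: left_diff_distrib)
      have "12 * (1 + c k) / (c k * real (L k)) \<le> 12 * (1 + c k) / (c k * w k)"
        using c w(1,2,4) by (intro divide_left_mono mult_left_mono mult_pos_pos) auto
      also have "\<dots> = 12 * sqrt (r k)" by (simp add: w(5) sqrt_r[OF c])
      finally have err: "12 * (1 + c k) / (c k * real (L k)) \<le> 12 * sqrt (r k)" .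
      have "?G (u - \<epsilon>) k \<le> measure_pmf.prob (balls_pmf k (p k))
          {T. M k T \<le> mean_M k (p k) + u * sqrt (var_M k (p k)) - real (L k) * real (k - 1)}"
        using shift by (intro measure_pmf.finite_measure_mono) auto
      thus ?case
        using M_star_cdf_ge[OF p k w(4), of "mean_M k (p k) + u * sqrt (var_M k (p k))"] err
        unfolding c_def by linarith
    qed
  qed
  have "?S \<longlonglongrightarrow> cdf std_normal_distribution u"
  proof (rule order_tendstoI)
    fix a assume "cdf std_normal_distribution u < a"
    hence "\<forall>\<^sub>F k in sequentially. ?G u k < a" by (rule order_tendstoD(2)[OF G])
    with upper show "\<forall>\<^sub>F k in sequentially. ?S k < a" by eventually_elim linarith
  next
    fix a assume a: "a < cdf std_normal_distribution u"
    \<comment> \<open>First \<open>\<epsilon>\<close> is chosen by continuity of the limit at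
      \<open>u\<close>, then \<open>k\<close> tends to infinity.\<close>
    have "((\<lambda>\<epsilon>. cdf std_normal_distribution (u - \<epsilon>)) \<longlongrightarrow> cdf std_normal_distribution (u - 0)) (at_right 0)"
      by (rule isCont_tendsto_compose[OF isCont_cdf_std_normal]) (intro tendsto_intros)
    hence "\<forall>\<^sub>F \<epsilon> in at_right 0. a < cdf std_normal_distribution (u - \<epsilon>)"
      using a by (intro order_tendstoD(1)) auto
    hence "\<forall>\<^sub>F \<epsilon> in at_right (0::real). 0 < \<epsilon> \<and> a < cdf std_normal_distribution (u - \<epsilon>)"
      using eventually_at_right_less by (rule eventually_conj[rotated])
    then obtain \<epsilon> where \<epsilon>: "0 < \<epsilon>" "a < cdf std_normal_distribution (u - \<epsilon>)"
      using eventually_happens'[OF trivial_limit_at_right_real] by blast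
    have "(\<lambda>k. ?G (u - \<epsilon>) k - 12 * sqrt (r k)) \<longlonglongrightarrow> cdf std_normal_distribution (u - \<epsilon>) - 12 * 0"
      by (intro tendsto_intros G r)
    hence "\<forall>\<^sub>F k in sequentially. a < ?G (u - \<epsilon>) k - 12 * sqrt (r k)"
      using \<epsilon> by (intro order_tendstoD(1)) auto
    with lower[OF \<epsilon>(1)] show "\<forall>\<^sub>F k in sequentially. a < ?S k" by eventually_elim linarith
  qed
  thus ?thesis by (simp only: cdf_std_normal_distribution)
qed

end
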